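(* For every $\Phi_0,\Phi_1\in\mathcal P_2(\mathsf{TX})$ and $\mu_1\in\mathcal P_2(\mathsf X)$ we have $$[\Phi_0,\mu_1]_r=\min\Big\{\int_{\mathsf{TX}\times\mathsf X}\langle x_0-x_1,v_0\rangle\,d\boldsymbol\sigma(x_0,v_0,x_1)\ :\ \boldsymbol\sigma\in\Lambda(\Phi_0,\mu_1)\Big\},$$ $$[\Phi_0,\Phi_1]_r=\min\Big\{\int_{\mathsf{TX}\times\mathsf{TX}}\langle x_0-x_1,v_0-v_1\rangle\,d\boldsymbol\Theta(x_0,v_0,x_1,v_1)\ :\ \boldsymbol\Theta\in\Lambda(\Phi_0,\Phi_1)\Big\}.$$
   Context: $\mathsf X$ is a separable real Hilbert space (possibly infinite dimensional) with norm $|\cdot|$ and scalar product $\langle\cdot,\cdot\rangle$. $\mathcal P_2(\mathsf X)$ is the set of Borel probability measures on $\mathsf X$ with finite second moment, with $L^2$-Wasserstein distance $W_2$; $\Gamma(\cdot,\cdot)$ denotes the set of couplings with the given marginals and $\Gamma_o(\mu,\nu)$ the set of optimal couplings (attaining $W_2(\mu,\nu)$). $\mathsf{TX}:=\mathsf X\times\mathsf X$ with points $(x,v)$; $\mathsf x(x,v):=x$, $\exp^t(x,v):=x+tv$. $\mathcal P_2(\mathsf{TX})$ is the set of Borel probability measures $\Phi$ on $\mathsf{TX}$ with $\int(|x|^2+|v|^2)\,d\Phi<\infty$. Pairings: for $\Phi_0,\Phi_1\in\mathcal P_2(\mathsf{TX})$ and $\mu_1\in\mathcal P_2(\mathsf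 X)$ (the limits exist), $$[\Phi_0,\mu_1]_r:=\lim_{s\downarrow0}\frac{W_2^2(\exp^s_\sharp\Phi_0,\mu_1)-W_2^2(\mathsf x_\sharp\Phi_0,\mu_1)}{2s},\qquad [\Phi_0,\Phi_1]_r:=\lim_{s\downarrow0}\frac{W_2^2(\exp^s_\sharp\Phi_0,\exp^s_\sharp\Phi_1)-W_2^2(\mathsf x_\sharp\Phi_0,\mathsf x_\sharp\Phi_1)}{2s}.$$ With $\mathsf x^0,\mathsf x^1$ the projections onto the $x_0$ and $x_1$ coordinates: $\Lambda(\Phi_0,\mu_1):=\{\boldsymbol\sigma\in\Gamma(\Phi_0,\mu_1):(\mathsf x^0,\mathsf x^1)_\sharp\boldsymbol\sigma\in\Gamma_o(\mathsf x_\sharp\Phi_0,\mu_1)\}$ (measures on $\mathsf{TX}\times\mathsf X$), and $\Lambda(\Phi_0,\Phi_1):=\{\boldsymbol\Theta\in\Gamma(\Phi_0,\Phi_1):(\mathsf x^0,\mathsf x^1)_\sharp\boldsymbol\Theta\in\Gamma_o(\mathsf x_\sharp\Phi_0,\mathsf x_\sharp\Phi_1)\}$ (measures on $\mathsf{TX}\times\mathsf{TX}$). *)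

theory Defs
  imports "HOL-Probability.Probability"
begin

(* A separable real Hilbert space is rendered as a type of sort {real_inner, polish_space}:
   an inner product space whose norm metric is complete and second countable. *)

(* Used both for the base space 'a and for the tangent bundle 'a * 'a, whose product norm
   satisfies (norm (x, v))^2 = (norm x)^2 + (norm v)^2. *)
definition P2 :: "'a::real_normed_vector measure set" where
  "P2 = {M. prob_space M \<and> sets M = sets borel \<and> (\<integral>\<^sup>+x. ennreal ((norm x)\<^sup>2) \<partial>M) < \<infinity>}"

definition couplings ::
    "'a::topological_space measure \<Rightarrow> 'b::topological_space measure \<Rightarrow> ('a \<times> 'b) measure set" where
  "couplings M N = {G. prob_space G \<and> sets G = sets borel \<and>
     distr G borel fst = M \<and> distr G borel snd = N}"

definition quadratic_cost :: "('a::real_normed_vector \<times> 'a) measure \<Rightarrow> ennreal" where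
  "quadratic_cost G = (\<integral>\<^sup>+(x, y). ennreal ((norm (x - y))\<^sup>2) \<partial>G)"

(* The infimum is finite whenever both arguments lie in P2. *)
definition W2 :: "'a::real_normed_vector measure \<Rightarrow> 'a measure \<Rightarrow> real" where
  "W2 M N = sqrt (enn2real (INF G\<in>couplings M N. quadratic_cost G))"

definition optimal_couplings ::
    "'a::real_normed_vector measure \<Rightarrow> 'a measure \<Rightarrow> ('a \<times> 'a) measure set" where
  "optimal_couplings M N = {G \<in> couplings M N. quadratic_cost G = ennreal ((W2 M N)\<^sup>2)}"

definition exp_map :: "real \<Rightarrow> 'a::real_normed_vector \<times> 'a \<Rightarrow> 'a" where
  "exp_map t = (\<lambda>(x, v). x + t *\<^sub>R v)"

definition pairing_base ::
    "('a::real_normed_vector \<times> 'a) measure \<Rightarrow> 'a measure \<Rightarrow> real" where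
  "pairing_base \<Phi> \<mu> = Lim (at_right 0) (\<lambda>s.
     ((W2 (distr \<Phi> borel (exp_map s)) \<mu>)\<^sup>2 - (W2 (distr \<Phi> borel fst) \<mu>)\<^sup>2) / (2 * s))"

definition pairing ::
    "('a::real_normed_vector \<times> 'a) measure \<Rightarrow> ('a \<times> 'a) measure \<Rightarrow> real" where
  "pairing \<Phi> \<Psi> = Lim (at_right 0) (\<lambda>s.
     ((W2 (distr \<Phi> borel (exp_map s)) (distr \<Psi> borel (exp_map s)))\<^sup>2
       - (W2 (distr \<Phi> borel fst) (distr \<Psi> borel fst))\<^sup>2) / (2 * s))"

definition Lambda_base ::
    "('a::real_normed_vector \<times> 'a) measure \<Rightarrow> 'a measure \<Rightarrow> (('a \<times> 'a) \<times> 'a) measure set" where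
  "Lambda_base \<Phi> \<mu> = {\<sigma> \<in> couplings \<Phi> \<mu>.
     distr \<sigma> borel (\<lambda>((x0, v0), x1). (x0, x1)) \<in> optimal_couplings (distr \<Phi> borel fst) \<mu>}"

definition Lambda ::
    "('a::real_normed_vector \<times> 'a) measure \<Rightarrow> ('a \<times> 'a) measure
      \<Rightarrow> (('a \<times> 'a) \<times> ('a \<times> 'a)) measure set" where
  "Lambda \<Phi> \<Psi> = {\<Theta> \<in> couplings \<Phi> \<Psi>.
     distr \<Theta> borel (\<lambda>((x0, v0), (x1, v1)). (x0, x1))
       \<in> optimal_couplings (distr \<Phi> borel fst) (distr \<Psi> borel fst)}"

(* Minimum of a possibly infinite set: Min is only meaningful for finite sets,
   and Inf would not assert attainment. *)
definition is_minimum :: "'a::order \<Rightarrow> 'a set \<Rightarrow> bool" where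
  "is_minimum m S \<longleftrightarrow> m \<in> S \<and> (\<forall>y\<in>S. m \<le> y)"

end

theory Submission
  imports Defs
begin

text \<open>
  Both pairings are one-sided derivatives at \<open>s = 0\<close> of the value of a minimisation problem, and the
  theorem is the envelope principle: over a compact set of competitors, such a derivative is the
  minimum, over the minimisers of the unperturbed problem, of the derivative of the cost.

  To have a set of competitors that does not move with \<open>s\<close>, couplings of the displaced measures are
  replaced by couplings \<open>\<Theta>\<close> of the tangent measures themselves. Every coupling of two push-forwards
  comes from a coupling of the original measures (\<open>lift_coupling\<close>), so \<open>W2\<close> squared at time \<open>s\<close> is
  the minimum over \<open>\<Theta>\<close> of
  \<open>\<integral> |x0 - x1|^2 + 2 s \<integral> (x0 - x1) \<bullet> (v0 - v1) + s^2 \<integral> |v0 - v1|^2\<close>.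
  The last integral is bounded uniformly in \<open>\<Theta>\<close>, so only the pair of real numbers formed by the
  first two integrals matters, and the envelope principle becomes a statement about a compact subset
  of the plane (\<open>tendsto_difference_quotient_compact_minimum\<close>).

  What has to be shown is that these pairs do form a compact set
  (\<open>compact_integral_inner_diff\<close>), and this is where infinite dimension could hurt: closed balls of
  the Hilbert space are not compact. Since the marginals are fixed, one can work with the values
  \<open>\<Theta> (A \<times> B)\<close> on rectangles instead of with weak convergence. These values form a
  bimeasure: a function of two sets, finitely additive in each, with prescribed marginals.
  Bimeasures form a closed subset of a product of unit intervals, hence a compact set by Tychonoff's
  theorem, and on Polish spaces every bimeasure extends to a coupling
  (\<open>polish_bimeasure.ex_coupling\<close>), because its marginals are inner regular with respect to compact
  sets. By approximation with simple functions, \<open>\<integral> f x \<bullet> g y\<close> depends continuously on the bimeasure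
  for all square-integrable \<open>f\<close> and \<open>g\<close>, and after expanding the products, the two integrals above
  are constants plus integrals of this form. The same extension result gives the lifting of couplings.

  The base pairing is the special case in which the second velocity is \<open>0\<close>.
\<close>

section \<open>Finitely additive functions of two sets\<close>

text \<open>
  The conditions tie down the values on Borel sets only; the bound by \<open>1\<close> is imposed on all pairs of
  sets, so that the whole set lies in a product of compact intervals.
\<close>

definition bimeasures ::
    "'s::topological_space measure \<Rightarrow> 't::topological_space measure \<Rightarrow> ('s set \<times> 't set \<Rightarrow> real) set" where
  "bimeasures P Q = {b. (\<forall>A B. 0 \<le> b (A, B) \<and> b (A, B) \<le> 1) \<and>
     (\<forall>A\<in>sets borel. \<forall>A'\<in>sets borel. \<forall>B\<in>sets borel. A \<inter> A' = {} \<longrightarrow>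
        b (A \<union> A', B) = b (A, B) + b (A', B)) \<and>
     (\<forall>A\<in>sets borel. \<forall>B\<in>sets borel. \<forall>B'\<in>sets borel. B \<inter> B' = {} \<longrightarrow>
        b (A, B \<union> B') = b (A, B) + b (A, B')) \<and>
     (\<forall>A\<in>sets borel. b (A, UNIV) = measure P A) \<and>
     (\<forall>B\<in>sets borel. b (UNIV, B) = measure Q B)}"

text \<open>
  The cells of the partition generated by the sets \<open>A i\<close>; some of them may be empty.
\<close>

definition atom :: "'i set \<Rightarrow> ('i \<Rightarrow> 'z set) \<Rightarrow> 'i set \<Rightarrow> 'z set" where
  "atom I A J = {x. {i\<in>I. x \<in> A i} = J}"

lemma atom_borel:
  fixes A :: "'i \<Rightarrow> 'z::topological_space set"
  assumes "finite I" and "\<And>i. i \<in> I \<Longrightarrow> A i \<in> sets borel"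
  shows "atom I A J \<in> sets borel"
proof -
  have "{i\<in>I. x \<in> A i} = J \<longleftrightarrow> J \<subseteq> I \<and> (\<forall>i\<in>I. x \<in> A i \<longleftrightarrow> i \<in> J)" for x by blast
  then have "atom I A J = (if J \<subseteq> I then {x \<in> space borel. \<forall>i\<in>I. x \<in> A i \<longleftrightarrow> i \<in> J} else {})"
    by (simp add: atom_def)
  moreover have "{x \<in> space borel. x \<in> A i \<longleftrightarrow> i \<in> J} \<in> sets borel" if "i \<in> I" for i
    using assms(2)[OF that] borel_comp[OF assms(2)[OF that]]
    by (cases "i \<in> J") (simp_all add: Compl_eq)
  then have "{x \<in> space borel. \<forall>i\<in>I. x \<in> A i \<longleftrightarrow> i \<in> J} \<in> sets borel"
    using assms(1) by (intro sets.sets_Collect_finite_All) auto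
  ultimately show ?thesis by simp
qed

lemma disjoint_atoms: "disjoint_family_on (atom I A) \<J>"
  by (auto simp: disjoint_family_on_def atom_def)

lemma Union_atoms:
  assumes "i \<in> I"
  shows "A i = (\<Union>J\<in>{J\<in>Pow I. i \<in> J}. atom I A J)"
proof (intro subset_antisym subsetI)
  fix x assume "x \<in> A i"
  then have "{j\<in>I. x \<in> A j} \<in> {J\<in>Pow I. i \<in> J}" and "x \<in> atom I A {j\<in>I. x \<in> A j}"
    using assms by (simp_all add: atom_def subset_iff)
  then show "x \<in> (\<Union>J\<in>{J\<in>Pow I. i \<in> J}. atom I A J)" by (rule UN_I)
next
  fix x assume "x \<in> (\<Union>J\<in>{J\<in>Pow I. i \<in> J}. atom I A J)"
  then obtain J where "i \<in> J" "{j\<in>I. x \<in> A j} = J" unfolding atom_def by blast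
  then show "x \<in> A i" by blast
qed

locale bimeasure =
  fixes P :: "'s::topological_space measure" and Q :: "'t::topological_space measure"
    and b :: "'s set \<times> 't set \<Rightarrow> real"
  assumes b: "b \<in> bimeasures P Q"
begin

lemma nonneg: "0 \<le> b (A, B)"
  using b by (auto simp: bimeasures_def)

lemma add_left: "A \<in> sets borel \<Longrightarrow> A' \<in> sets borel \<Longrightarrow> B \<in> sets borel \<Longrightarrow> A \<inter> A' = {} \<Longrightarrow>
    b (A \<union> A', B) = b (A, B) + b (A', B)"
  and add_right: "A \<in> sets borel \<Longrightarrow> B \<in> sets borel \<Longrightarrow> B' \<in> sets borel \<Longrightarrow> B \<inter> B' = {} \<Longrightarrow>
    b (A, B \<union> B') = b (A, B) + b (A, B')"
  and marginal_left: "A \<in> sets borel \<Longrightarrow> b (A, UNIV) = measure P A"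
  and marginal_right: "B \<in> sets borel \<Longrightarrow> b (UNIV, B) = measure Q B"
  using b by (auto simp: bimeasures_def)

lemma empty_left: "B \<in> sets borel \<Longrightarrow> b ({}, B) = 0"
  using add_left[of "{}" "{}" B] by simp

lemma empty_right: "A \<in> sets borel \<Longrightarrow> b (A, {}) = 0"
  using add_right[of A "{}" "{}"] by simp

lemma sum_left:
  assumes "finite I" "\<And>i. i \<in> I \<Longrightarrow> A i \<in> sets borel" "disjoint_family_on A I" "B \<in> sets borel"
  shows "b ((\<Union>i\<in>I. A i), B) = (\<Sum>i\<in>I. b (A i, B))"
  using assms(1-3)
proof (induction I)
  case empty then show ?case using assms(4) by (simp add: empty_left)
next
  case (insert i I)
  have "b (A i \<union> (\<Union>j\<in>I. A j), B) = b (A i, B) + b ((\<Union>j\<in>I. A j), B)"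
    using insert assms(4) by (intro add_left) (auto simp: disjoint_family_on_def)
  then show ?case using insert by (simp add: disjoint_family_on_insert)
qed

lemma sum_right:
  assumes "finite I" "\<And>i. i \<in> I \<Longrightarrow> B i \<in> sets borel" "disjoint_family_on B I" "A \<in> sets borel"
  shows "b (A, (\<Union>i\<in>I. B i)) = (\<Sum>i\<in>I. b (A, B i))"
  using assms(1-3)
proof (induction I)
  case empty then show ?case using assms(4) by (simp add: empty_right)
next
  case (insert i I)
  have "b (A, B i \<union> (\<Union>j\<in>I. B j)) = b (A, B i) + b (A, (\<Union>j\<in>I. B j))"
    using insert assms(4) by (intro add_right) (auto simp: disjoint_family_on_def)
  then show ?case using insert by (simp add: disjoint_family_on_insert)
qed

text \<open>
  On the finitely many cells generated by the \<open>A i\<close> and the \<open>B i\<close>, a bimeasure acts as a measure with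
  nonnegative masses, and on each nonempty product cell the combination of indicators is a constant,
  nonnegative by assumption. All the inequalities between values on rectangles that are needed below
  follow from this one.
\<close>

lemma positivity:
  fixes c :: "'i \<Rightarrow> real"
  assumes I: "finite I" and A: "\<And>i. i \<in> I \<Longrightarrow> A i \<in> sets borel" and B: "\<And>i. i \<in> I \<Longrightarrow> B i \<in> sets borel"
    and pos: "\<And>x y. 0 \<le> (\<Sum>i\<in>I. c i * (indicator (A i) x * indicator (B i) y))"
  shows "0 \<le> (\<Sum>i\<in>I. c i * b (A i, B i))"
proof -
  let ?b = "\<lambda>J J'. b (atom I A J, atom I B J')"
  have "b (A i, B i) = (\<Sum>J\<in>Pow I. \<Sum>J'\<in>Pow I. (if i \<in> J \<inter> J' then 1 else 0) * ?b J J')"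
    if i: "i \<in> I" for i
  proof -
    have "b (A i, B i) = b ((\<Union>J\<in>{J\<in>Pow I. i \<in> J}. atom I A J), B i)"
      using Union_atoms[OF i, of A] by simp
    also have "\<dots> = (\<Sum>J\<in>{J\<in>Pow I. i \<in> J}. b (atom I A J, B i))"
      using I B i by (intro sum_left atom_borel I A disjoint_atoms) auto
    also have "\<dots> = (\<Sum>J\<in>{J\<in>Pow I. i \<in> J}. b (atom I A J, (\<Union>J\<in>{J\<in>Pow I. i \<in> J}. atom I B J)))"
      using Union_atoms[OF i, of B] by simp
    also have "\<dots> = (\<Sum>J\<in>{J\<in>Pow I. i \<in> J}. \<Sum>J'\<in>{J\<in>Pow I. i \<in> J}. ?b J J')"
      using I by (intro sum.cong refl sum_right atom_borel I A B disjoint_atoms) auto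
    also have "\<dots> = (\<Sum>J\<in>Pow I. if i \<in> J then (\<Sum>J'\<in>Pow I. if i \<in> J' then ?b J J' else 0) else 0)"
      using I by (simp only: sum.inter_filter finite_Pow_iff)
    also have "\<dots> = (\<Sum>J\<in>Pow I. \<Sum>J'\<in>Pow I. (if i \<in> J \<inter> J' then 1 else 0) * ?b J J')"
      by (intro sum.cong refl) (auto intro!: sum.cong)
    finally show ?thesis .
  qed
  then have "(\<Sum>i\<in>I. c i * b (A i, B i))
      = (\<Sum>i\<in>I. \<Sum>J\<in>Pow I. \<Sum>J'\<in>Pow I. c i * (if i \<in> J \<inter> J' then 1 else 0) * ?b J J')"
    by (simp add: sum_distrib_left mult.assoc)
  also have "\<dots> = (\<Sum>J\<in>Pow I. \<Sum>i\<in>I. \<Sum>J'\<in>Pow I. c i * (if i \<in> J \<inter> J' then 1 else 0) * ?b J J')"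
    by (rule sum.swap)
  also have "\<dots> = (\<Sum>J\<in>Pow I. \<Sum>J'\<in>Pow I. \<Sum>i\<in>I. c i * (if i \<in> J \<inter> J' then 1 else 0) * ?b J J')"
    by (rule sum.cong[OF refl sum.swap])
  also have "\<dots> = (\<Sum>J\<in>Pow I. \<Sum>J'\<in>Pow I. (\<Sum>i\<in>I. c i * (if i \<in> J \<inter> J' then 1 else 0)) * ?b J J')"
    by (simp add: sum_distrib_right)
  also have "\<dots> \<ge> 0"
  proof (intro sum_nonneg)
    fix J J' assume J: "J \<in> Pow I" "J' \<in> Pow I"
    show "0 \<le> (\<Sum>i\<in>I. c i * (if i \<in> J \<inter> J' then 1 else 0)) * ?b J J'"
    proof (cases "atom I A J = {} \<or> atom I B J' = {}")
      case True
      then have "?b J J' = 0" by (metis empty_left empty_right atom_borel[OF I] A B)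
      then show ?thesis by simp
    next
      case False
      then obtain x y where "x \<in> atom I A J" "y \<in> atom I B J'" by blast
      then have "(if i \<in> J \<inter> J' then 1 else 0 :: real) = indicator (A i) x * indicator (B i) y"
        if "i \<in> I" for i using that by (auto simp: atom_def indicator_def)
      then have "(\<Sum>i\<in>I. c i * (if i \<in> J \<inter> J' then 1 else 0))
          = (\<Sum>i\<in>I. c i * (indicator (A i) x * indicator (B i) y))"
        by (intro sum.cong) auto
      then show ?thesis using pos[of x y] nonneg by simp
    qed
  qed
  finally show ?thesis .
qed

lemma mono:
  assumes "A \<in> sets borel" "A' \<in> sets borel" "B \<in> sets borel" "B' \<in> sets borel" "A \<subseteq> A'" "B \<subseteq> B'"
  shows "b (A, B) \<le> b (A', B')"
proof -
  have "b (A', B') = b (A, B) + b (A, B' - B) + b (A' - A, B')"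
    using add_left[of A "A' - A" B'] add_right[of A B "B' - B"] assms
    by (simp add: Un_absorb1)
  then show ?thesis using nonneg[of A "B' - B"] nonneg[of "A' - A" B'] by linarith
qed

lemma enlarge:
  assumes "A \<in> sets borel" "A' \<in> sets borel" "B \<in> sets borel" "B' \<in> sets borel" "A \<subseteq> A'" "B \<subseteq> B'"
  shows "b (A', B') \<le> b (A, B) + measure P (A' - A) + measure Q (B' - B)"
proof -
  have "b (A', B') = b (A, B) + b (A, B' - B) + b (A' - A, B')"
    using add_left[of A "A' - A" B'] add_right[of A B "B' - B"] assms
    by (simp add: Un_absorb1)
  moreover have "b (A' - A, B') \<le> measure P (A' - A)"
    using mono[of "A' - A" "A' - A" B' UNIV] assms by (simp add: marginal_left)
  moreover have "b (A, B' - B) \<le> measure Q (B' - B)"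
    using mono[of A UNIV "B' - B" "B' - B"] assms by (simp add: marginal_right)
  ultimately show ?thesis by linarith
qed

text \<open>
  Positivity, applied to the indicator of the large rectangle minus the sum of the others; the index
  \<open>None\<close> stands for the large rectangle.
\<close>

lemma packing:
  assumes "finite I" "\<And>i. i \<in> I \<Longrightarrow> A i \<in> sets borel" "\<And>i. i \<in> I \<Longrightarrow> B i \<in> sets borel"
    and "A0 \<in> sets borel" "B0 \<in> sets borel"
    and disj: "disjoint_family_on (\<lambda>i. A i \<times> B i) I" and sub: "(\<Union>i\<in>I. A i \<times> B i) \<subseteq> A0 \<times> B0"
  shows "(\<Sum>i\<in>I. b (A i, B i)) \<le> b (A0, B0)"
proof -
  let ?c = "\<lambda>i. case i of None \<Rightarrow> (1::real) | Some i \<Rightarrow> -1"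
  let ?A = "\<lambda>i. case i of None \<Rightarrow> A0 | Some i \<Rightarrow> A i"
  let ?B = "\<lambda>i. case i of None \<Rightarrow> B0 | Some i \<Rightarrow> B i"
  have split: "(\<Sum>i\<in>insert None (Some ` I). g i) = g None + (\<Sum>i\<in>I. g (Some i))"
    for g :: "_ \<Rightarrow> real"
    using assms(1) by (subst sum.insert) (auto simp: sum.reindex)
  have "0 \<le> (\<Sum>i\<in>insert None (Some ` I). ?c i * b (?A i, ?B i))"
  proof (rule positivity)
    fix x y
    have "(\<Sum>i\<in>I. indicator (A i) x * indicator (B i) y) = (\<Sum>i\<in>I. indicator (A i \<times> B i) (x, y) :: real)"
      by (simp add: indicator_times)
    also have "\<dots> = indicator (\<Union>i\<in>I. A i \<times> B i) (x, y)"
      by (rule indicator_UN_disjoint[OF assms(1) disj, symmetric])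
    also have "\<dots> \<le> indicator (A0 \<times> B0) (x, y)"
      using sub by (intro indicator_leI) auto
    also have "\<dots> = indicator A0 x * indicator B0 y"
      by (simp add: indicator_times)
    finally show "0 \<le> (\<Sum>i\<in>insert None (Some ` I). ?c i * (indicator (?A i) x * indicator (?B i) y))"
      unfolding split by (simp add: sum_negf)
  qed (use assms(1-5) in auto)
  then show ?thesis unfolding split by (simp add: sum_negf)
qed

lemma covering:
  assumes "finite I" "\<And>i. i \<in> I \<Longrightarrow> A i \<in> sets borel" "\<And>i. i \<in> I \<Longrightarrow> B i \<in> sets borel"
    and "A0 \<in> sets borel" "B0 \<in> sets borel"
    and sub: "A0 \<times> B0 \<subseteq> (\<Union>i\<in>I. A i \<times> B i)"
  shows "b (A0, B0) \<le> (\<Sum>i\<in>I. b (A i, B i))"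
proof -
  let ?c = "\<lambda>i. case i of None \<Rightarrow> (-1::real) | Some i \<Rightarrow> 1"
  let ?A = "\<lambda>i. case i of None \<Rightarrow> A0 | Some i \<Rightarrow> A i"
  let ?B = "\<lambda>i. case i of None \<Rightarrow> B0 | Some i \<Rightarrow> B i"
  have split: "(\<Sum>i\<in>insert None (Some ` I). g i) = g None + (\<Sum>i\<in>I. g (Some i))"
    for g :: "_ \<Rightarrow> real"
    using assms(1) by (subst sum.insert) (auto simp: sum.reindex)
  have "0 \<le> (\<Sum>i\<in>insert None (Some ` I). ?c i * b (?A i, ?B i))"
  proof (rule positivity)
    fix x y
    have "indicator A0 x * indicator B0 y \<le> (\<Sum>i\<in>I. indicator (A i) x * indicator (B i) y :: real)"
    proof (cases "(x, y) \<in> A0 \<times> B0")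
      case True
      then have "(x, y) \<in> (\<Union>i\<in>I. A i \<times> B i)" by (rule subsetD[OF sub])
      then obtain i where i: "i \<in> I" "x \<in> A i" "y \<in> B i" by auto
      then have "1 = indicator (A i) x * (indicator (B i) y :: real)" by simp
      also have "\<dots> \<le> (\<Sum>i\<in>I. indicator (A i) x * indicator (B i) y)"
        using assms(1) i by (intro member_le_sum) auto
      finally show ?thesis using True by simp
    next
      case False
      then show ?thesis by (auto simp: indicator_def intro!: sum_nonneg)
    qed
    then show "0 \<le> (\<Sum>i\<in>insert None (Some ` I). ?c i * (indicator (?A i) x * indicator (?B i) y))"
      unfolding split by simp
  qed (use assms(1-5) in auto)
  then show ?thesis unfolding split by simp
qed

end

section \<open>Bimeasures on Polish spaces are couplings\<close>

lemma ex_compact_subset_measure_lt: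
  fixes M :: "'a::{second_countable_topology, complete_space} measure"
  assumes "finite_measure M" and sets: "sets M = sets borel" and A: "A \<in> sets borel" and e: "0 < e"
  obtains K where "K \<subseteq> A" "compact K" "measure M (A - K) < e"
proof -
  interpret finite_measure M by fact
  have "\<exists>K\<in>{K. K \<subseteq> A \<and> compact K}. measure M A - e < measure M K"
  proof (cases "measure M A < e")
    case False
    then have "ennreal (measure M A - e) < ennreal (measure M A)"
      using e by (intro ennreal_lessI) auto
    then have "ennreal (measure M A - e) < emeasure M A"
      by (simp add: emeasure_eq_measure)
    then have "ennreal (measure M A - e) < (SUP K\<in>{K. K \<subseteq> A \<and> compact K}. emeasure M K)"
      by (subst (asm) inner_regular[OF sets _ A]) auto
    then obtain K where "K \<in> {K. K \<subseteq> A \<and> compact K}" "ennreal (measure M A - e) < ennreal (measure M K)"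
      unfolding less_SUP_iff emeasure_eq_measure by blast
    then show ?thesis using False by (auto simp: ennreal_less_iff)
  qed (auto intro!: bexI[of _ "{}"])
  then obtain K where K: "K \<subseteq> A" "compact K" "measure M A - e < measure M K" by blast
  have "measure M (A - K) = measure M A - measure M K"
    using A K sets by (intro finite_measure_Diff) (auto intro!: borel_compact)
  with that[OF K(1,2)] K(3) show ?thesis by simp
qed

lemma ex_open_superset_measure_lt:
  fixes M :: "'a::{second_countable_topology, complete_space} measure"
  assumes "finite_measure M" and sets: "sets M = sets borel" and A: "A \<in> sets borel" and e: "0 < e"
  obtains U where "A \<subseteq> U" "open U" "measure M (U - A) < e"
proof -
  interpret finite_measure M by fact
  have "emeasure M A < ennreal (measure M A + e)"
    using e by (simp add: emeasure_eq_measure ennreal_lessI add_nonneg_pos)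
  then have "(INF U\<in>{U. A \<subseteq> U \<and> open U}. emeasure M U) < ennreal (measure M A + e)"
    by (subst (asm) outer_regular[OF sets _ A]) auto
  then obtain U where U: "A \<subseteq> U" "open U" "ennreal (measure M U) < ennreal (measure M A + e)"
    unfolding INF_less_iff emeasure_eq_measure by blast
  moreover have "measure M (U - A) = measure M U - measure M A"
    using A U sets by (intro finite_measure_Diff) auto
  ultimately show ?thesis using that e by (simp add: ennreal_less_iff flip: ennreal_plus)
qed

locale polish_marginals =
  fixes P :: "'s::{second_countable_topology, complete_space} measure"
    and Q :: "'t::{second_countable_topology, complete_space} measure"
  assumes prob_P: "prob_space P" and prob_Q: "prob_space Q"
    and sets_P: "sets P = sets borel" and sets_Q: "sets Q = sets borel"
begin

sublocale P: prob_space P by (rule prob_P)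

sublocale Q: prob_space Q by (rule prob_Q)

lemma space_P: "space P = UNIV" and space_Q: "space Q = UNIV"
  using sets_eq_imp_space_eq[OF sets_P] sets_eq_imp_space_eq[OF sets_Q] by simp_all

end

locale polish_bimeasure = polish_marginals P Q + bimeasure P Q b
  for P :: "'s::{second_countable_topology, complete_space} measure"
    and Q :: "'t::{second_countable_topology, complete_space} measure" and b
begin

text \<open>
  The nontrivial inequality is a compactness argument. The rectangle is approximated from inside by a
  compact one and the pieces of the partition from outside by open ones, all up to small errors of the
  marginals, which control the errors of the bimeasure. Finitely many open pieces cover the compact
  rectangle, and for these finite additivity suffices.
\<close>

lemma countably_additive_rectangles:
  fixes A :: "nat \<Rightarrow> 's set" and B :: "nat \<Rightarrow> 't set"
  assumes AB: "\<And>n. A n \<in> sets borel" "\<And>n. B n \<in> sets borel" "A0 \<in> sets borel" "B0 \<in> sets borel"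
    and disj: "disjoint_family (\<lambda>n. A n \<times> B n)" and Un: "(\<Union>n. A n \<times> B n) = A0 \<times> B0"
  shows "(\<Sum>n. ennreal (b (A n, B n))) = ennreal (b (A0, B0))"
proof (rule antisym)
  have "(\<Sum>n<N. b (A n, B n)) \<le> b (A0, B0)" for N
  proof (rule packing)
    show "disjoint_family_on (\<lambda>i. A i \<times> B i) {..<N}"
      using disj by (rule disjoint_family_on_mono[OF subset_UNIV])
    show "(\<Union>i<N. A i \<times> B i) \<subseteq> A0 \<times> B0" unfolding Un[symmetric] by blast
  qed (use AB in auto)
  then show "(\<Sum>n. ennreal (b (A n, B n))) \<le> ennreal (b (A0, B0))"
    by (intro suminf_le_const summableI) (simp add: sum_ennreal nonneg ennreal_leI)
next
  note regular_P = P.finite_measure_axioms sets_P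
  note regular_Q = Q.finite_measure_axioms sets_Q
  show "ennreal (b (A0, B0)) \<le> (\<Sum>n. ennreal (b (A n, B n)))"
  proof (rule ennreal_le_epsilon)
    fix e :: real assume e: "0 < e"
    \<comment> \<open>The error \<open>e\<close> is split into a quarter for each of the two compact sets and
        a quarter in total for each of the two sequences of open sets.\<close>
    define d where "d n = e / 4 * (1/2) ^ Suc n" for n :: nat
    have d_pos: "0 < d n" for n using e by (simp add: d_def)
    have sum_d: "(\<Sum>n\<in>I. d n) \<le> e / 4" if "finite I" for I
    proof -
      have "(\<Sum>n\<in>I. d n) \<le> (\<Sum>n. d n)"
        using d_pos power_half_series that unfolding d_def
        by (intro sum_le_suminf summable_mult) (auto simp: sums_iff less_imp_le)
      also have "\<dots> = e / 4"
        using power_half_series unfolding d_def by (subst suminf_mult) (auto simp: sums_iff)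
      finally show ?thesis .
    qed
    obtain K where K: "K \<subseteq> A0" "compact K" "measure P (A0 - K) < e / 4"
      using ex_compact_subset_measure_lt[OF regular_P AB(3), of "e/4"] e by auto
    obtain L where L: "L \<subseteq> B0" "compact L" "measure Q (B0 - L) < e / 4"
      using ex_compact_subset_measure_lt[OF regular_Q AB(4), of "e/4"] e by auto
    have "\<exists>U. A n \<subseteq> U \<and> open U \<and> measure P (U - A n) < d n" for n
      using ex_open_superset_measure_lt[OF regular_P AB(1) d_pos] by metis
    then obtain U where U: "\<And>n. A n \<subseteq> U n" "\<And>n. open (U n)" "\<And>n. measure P (U n - A n) < d n"
      by metis
    have "\<exists>V. B n \<subseteq> V \<and> open V \<and> measure Q (V - B n) < d n" for n
      using ex_open_superset_measure_lt[OF regular_Q AB(2) d_pos] by metis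
    then obtain V where V: "\<And>n. B n \<subseteq> V n" "\<And>n. open (V n)" "\<And>n. measure Q (V n - B n) < d n"
      by metis
    have "K \<times> L \<subseteq> (\<Union>n. A n \<times> B n)" unfolding Un using K L by blast
    also have "\<dots> \<subseteq> (\<Union>n. U n \<times> V n)" using U(1) V(1) by blast
    finally have "K \<times> L \<subseteq> (\<Union>n. U n \<times> V n)" .
    from compactE_image[OF compact_Times[OF K(2) L(2)] open_Times[OF U(2) V(2)] this]
    obtain I where I: "finite I" "K \<times> L \<subseteq> (\<Union>n\<in>I. U n \<times> V n)" by metis
    have borel: "K \<in> sets borel" "L \<in> sets borel" "\<And>n. U n \<in> sets borel" "\<And>n. V n \<in> sets borel"
      using K(2) L(2) U(2) V(2) by (auto intro: borel_compact borel_open)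
    have "b (A0, B0) \<le> b (K, L) + measure P (A0 - K) + measure Q (B0 - L)"
      by (rule enlarge) (use K(1) L(1) AB borel in auto)
    also have "b (K, L) \<le> (\<Sum>n\<in>I. b (U n, V n))"
      by (rule covering) (use I borel in auto)
    also have "\<dots> \<le> (\<Sum>n\<in>I. b (A n, B n) + d n + d n)"
    proof (rule sum_mono)
      fix n
      have "b (U n, V n) \<le> b (A n, B n) + measure P (U n - A n) + measure Q (V n - B n)"
        by (rule enlarge) (use U(1) V(1) AB borel in auto)
      then show "b (U n, V n) \<le> b (A n, B n) + d n + d n" using U(3)[of n] V(3)[of n] by linarith
    qed
    also have "\<dots> = (\<Sum>n\<in>I. b (A n, B n)) + (\<Sum>n\<in>I. d n) + (\<Sum>n\<in>I. d n)"
      by (simp only: sum.distrib)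
    finally have "b (A0, B0) \<le> (\<Sum>n\<in>I. b (A n, B n)) + e"
      using sum_d[OF I(1)] K(3) L(3) by linarith
    then have "ennreal (b (A0, B0)) \<le> (\<Sum>n\<in>I. ennreal (b (A n, B n))) + ennreal e"
      using e by (simp add: sum_ennreal nonneg sum_nonneg flip: ennreal_plus)
    also have "(\<Sum>n\<in>I. ennreal (b (A n, B n))) \<le> (\<Sum>n. ennreal (b (A n, B n)))"
      using I(1) by (intro sum_le_suminf summableI) auto
    finally show "ennreal (b (A0, B0)) \<le> (\<Sum>n. ennreal (b (A n, B n))) + ennreal e"
      by (simp add: add_right_mono)
  qed
qed

text \<open>
  Rectangles form a semiring that generates the Borel sets of the product, so Caratheodory's extension
  theorem applies to the countably additive function just obtained.
\<close>

theorem ex_coupling: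
  obtains G where "G \<in> couplings P Q"
    and "\<And>A B. A \<in> sets borel \<Longrightarrow> B \<in> sets borel \<Longrightarrow> measure G (A \<times> B) = b (A, B)"
proof -
  let ?R = "{(A :: 's set, B :: 't set). A \<in> sets borel \<and> B \<in> sets borel}"
  define G where "G = extend_measure UNIV ?R (\<lambda>(A, B). A \<times> B) (\<lambda>(A, B). ennreal (b (A, B)))"
  have semiring: "semiring_of_sets UNIV {A \<times> B | A B. A \<in> sets (borel :: 's measure) \<and> B \<in> sets (borel :: 't measure)}"
    (is "semiring_of_sets _ ?S")
  proof
    have S_I: "A \<times> B \<in> ?S" if "A \<in> sets borel" "B \<in> sets borel" for A B
      using that by blast
    show "{} \<in> ?S" using S_I[of "{}" "{}"] by simp
    fix a c assume "a \<in> ?S" "c \<in> ?S"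
    then obtain A B A' B' where ac: "a = A \<times> B" "c = A' \<times> B'"
      and [measurable]: "A \<in> sets borel" "B \<in> sets borel" "A' \<in> sets borel" "B' \<in> sets borel"
      by auto
    have "a \<inter> c = (A \<inter> A') \<times> (B \<inter> B')" by (auto simp: ac)
    then show "a \<inter> c \<in> ?S" using S_I[of "A \<inter> A'" "B \<inter> B'"] by simp
    have "a - c = \<Union>{(A - A') \<times> B, (A \<inter> A') \<times> (B - B')}" by (auto simp: ac)
    moreover have "disjoint {(A - A') \<times> B, (A \<inter> A') \<times> (B - B')}"
      by (auto simp: disjoint_def)
    moreover have "{(A - A') \<times> B, (A \<inter> A') \<times> (B - B')} \<subseteq> ?S"
      using S_I[of "A - A'" B] S_I[of "A \<inter> A'" "B - B'"] by simp
    moreover have "finite {(A - A') \<times> B, (A \<inter> A') \<times> (B - B')}" by simp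
    ultimately show "\<exists>C\<subseteq>?S. finite C \<and> disjoint C \<and> a - c = \<Union>C"
      by (intro exI[of _ "{(A - A') \<times> B, (A \<inter> A') \<times> (B - B')}"] conjI)
  qed simp
  have rect: "emeasure G (A \<times> B) = ennreal (b (A, B))"
    if "A \<in> sets borel" "B \<in> sets borel" for A :: "'s set" and B :: "'t set"
  proof (rule extend_measure_caratheodory_pair[OF G_def _ semiring])
    show "A \<in> sets borel \<and> B \<in> sets borel" using that by blast
  next
    fix A :: "'s set" and B :: "'t set"
    assume "A \<in> sets borel \<and> B \<in> sets borel" "A \<times> B = {}"
    then show "ennreal (b (A, B)) = 0" by (auto simp: empty_left empty_right)
  next
    fix A A' :: "'s set" and B B' :: "'t set"
    assume *: "A \<in> sets borel \<and> B \<in> sets borel" "A' \<in> sets borel \<and> B' \<in> sets borel"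
      and "A \<times> B = A' \<times> B'"
    then consider "A = A'" "B = B'" | "A = {} \<or> B = {}" "A' = {} \<or> B' = {}"
      by (auto simp: times_eq_iff)
    then show "ennreal (b (A, B)) = ennreal (b (A', B'))"
      using * by cases (auto simp: empty_left empty_right)
  qed (simp_all add: countably_additive_rectangles)
  have "sets G = sigma_sets UNIV ((\<lambda>(A, B). A \<times> B) ` ?R)"
    unfolding G_def by (subst sets_extend_measure) auto
  also have "(\<lambda>(A, B). A \<times> B) ` ?R = ?S" by auto
  also have "sigma_sets UNIV ?S = sets (borel \<Otimes>\<^sub>M borel :: ('s \<times> 't) measure)"
    by (simp add: sets_pair_measure)
  finally have prod: "sets G = sets (borel \<Otimes>\<^sub>M borel)" .
  also have "\<dots> = sets borel" by (rule arg_cong[OF borel_prod, of sets])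
  finally have sets: "sets G = sets borel" .
  have space: "space G = UNIV" using sets_eq_imp_space_eq[OF sets] by simp
  note prod[measurable_cong]
  have "emeasure G (space G) = 1"
    using rect[of UNIV UNIV] P.prob_space
    by (simp add: space marginal_left space_P space_Q)
  then have "prob_space G" by (rule prob_spaceI)
  moreover have "distr G borel fst = P"
  proof (rule measure_eqI)
    fix A assume "A \<in> sets (distr G borel fst)"
    then have A[measurable]: "A \<in> sets borel" by simp
    have "emeasure (distr G borel fst) A = emeasure G (A \<times> UNIV)"
      by (subst emeasure_distr) (auto simp: space intro!: arg_cong[where f="emeasure G"])
    then show "emeasure (distr G borel fst) A = emeasure P A"
      using rect[of A UNIV] A by (simp add: marginal_left P.emeasure_eq_measure)
  qed (simp add: sets_P)
  moreover have "distr G borel snd = Q"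
  proof (rule measure_eqI)
    fix B assume "B \<in> sets (distr G borel snd)"
    then have B[measurable]: "B \<in> sets borel" by simp
    have "emeasure (distr G borel snd) B = emeasure G (UNIV \<times> B)"
      by (subst emeasure_distr) (auto simp: space intro!: arg_cong[where f="emeasure G"])
    then show "emeasure (distr G borel snd) B = emeasure Q B"
      using rect[of UNIV B] B by (simp add: marginal_right Q.emeasure_eq_measure)
  qed (simp add: sets_Q)
  ultimately have "G \<in> couplings P Q" using sets by (simp add: couplings_def)
  moreover have "measure G (A \<times> B) = b (A, B)" if "A \<in> sets borel" "B \<in> sets borel" for A B
    using rect[OF that] by (simp add: measure_def nonneg)
  ultimately show ?thesis using that by blast
qed

end

lemma sets_borel_prod:
  "sets (borel \<Otimes>\<^sub>M borel) = sets (borel :: ('a::second_countable_topology \<times> 'b::second_countable_topology) measure)"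
  by (rule arg_cong[OF borel_prod, of sets])

lemma measure_eqI_borel_rectangles:
  fixes G H :: "('a::second_countable_topology \<times> 'b::second_countable_topology) measure"
  assumes "finite_measure G" "finite_measure H" and sets: "sets G = sets borel" "sets H = sets borel"
    and eq: "\<And>A B. A \<in> sets borel \<Longrightarrow> B \<in> sets borel \<Longrightarrow> measure G (A \<times> B) = measure H (A \<times> B)"
  shows "G = H"
proof -
  interpret G: finite_measure G by fact
  interpret H: finite_measure H by fact
  let ?E = "{A \<times> B | A B. A \<in> sets (borel :: 'a measure) \<and> B \<in> sets (borel :: 'b measure)}"
  have gen: "sets (borel :: ('a \<times> 'b) measure) = sigma_sets UNIV ?E"
    unfolding sets_borel_prod[symmetric] by (simp add: sets_pair_measure)
  show ?thesis
  proof (rule measure_eqI_generator_eq[where E="?E" and \<Omega>=UNIV and A="\<lambda>_. UNIV"])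
    show "Int_stable ?E" by (rule Int_stable_pair_measure_generator)
    show "range (\<lambda>_. UNIV) \<subseteq> ?E" by (auto intro!: exI[of _ UNIV])
  qed (auto simp: eq G.emeasure_eq_measure H.emeasure_eq_measure sets gen)
qed

section \<open>Square-integrable maps\<close>

definition square_integrable ::
    "'s::topological_space measure \<Rightarrow> ('s \<Rightarrow> 'a::real_normed_vector) set" where
  "square_integrable M = {f \<in> borel_measurable borel. integrable M (\<lambda>x. (norm (f x))\<^sup>2)}"

lemma square_integrableI:
  "f \<in> borel_measurable borel \<Longrightarrow> integrable M (\<lambda>x. (norm (f x))\<^sup>2) \<Longrightarrow> f \<in> square_integrable M"
  and square_integrable_measurable: "f \<in> square_integrable M \<Longrightarrow> f \<in> borel_measurable borel"
  and square_integrable_integrable: "f \<in> square_integrable M \<Longrightarrow> integrable M (\<lambda>x. (norm (f x))\<^sup>2)"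
  by (auto simp: square_integrable_def)

lemma norm_add_scaleR_power2_le:
  fixes u v :: "'a::real_normed_vector"
  shows "(norm (u + c *\<^sub>R v))\<^sup>2 \<le> 2 * (norm u)\<^sup>2 + 2 * c\<^sup>2 * (norm v)\<^sup>2"
proof -
  have "(norm (u + c *\<^sub>R v))\<^sup>2 \<le> (norm u + \<bar>c\<bar> * norm v)\<^sup>2"
    using norm_triangle_ineq[of u "c *\<^sub>R v"] by (intro power_mono) auto
  also have "\<dots> \<le> 2 * (norm u)\<^sup>2 + 2 * (\<bar>c\<bar> * norm v)\<^sup>2"
    using sum_squares_bound[of "norm u" "\<bar>c\<bar> * norm v"] by (simp add: power2_sum)
  finally show ?thesis by (simp add: power_mult_distrib mult.assoc)
qed

lemma square_integrable_add_scaleR: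
  fixes f g :: "'s::topological_space \<Rightarrow> 'a::{real_normed_vector, second_countable_topology}"
  assumes "sets M = sets borel" "f \<in> square_integrable M" "g \<in> square_integrable M"
  shows "(\<lambda>x. f x + c *\<^sub>R g x) \<in> square_integrable M"
proof (rule square_integrableI)
  note [measurable] = assms(2,3)[THEN square_integrable_measurable]
  note [measurable_cong] = assms(1)
  show "(\<lambda>x. f x + c *\<^sub>R g x) \<in> borel_measurable borel" by measurable
  show "integrable M (\<lambda>x. (norm (f x + c *\<^sub>R g x))\<^sup>2)"
  proof (rule Bochner_Integration.integrable_bound)
    show "integrable M (\<lambda>x. 2 * (norm (f x))\<^sup>2 + 2 * c\<^sup>2 * (norm (g x))\<^sup>2)"
      using assms(2,3)[THEN square_integrable_integrable]
      by (intro Bochner_Integration.integrable_add integrable_mult_right)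
    show "AE x in M. norm ((norm (f x + c *\<^sub>R g x))\<^sup>2)
        \<le> norm (2 * (norm (f x))\<^sup>2 + 2 * c\<^sup>2 * (norm (g x))\<^sup>2)"
      using norm_add_scaleR_power2_le by (intro AE_I2) simp
  qed measurable
qed

text \<open>
  Simple functions converging pointwise to \<open>f\<close> and dominated by \<open>2 * norm f\<close> exist by separability;
  dominated convergence turns this into convergence of the squared distances.
\<close>

lemma square_integrable_simple_approx:
  fixes f :: "'s::topological_space \<Rightarrow> 'a::{real_normed_vector, second_countable_topology}"
  assumes sets: "sets M = sets borel" and f: "f \<in> square_integrable M" and "0 < \<delta>"
  obtains h where "simple_function borel h" "h \<in> square_integrable M"
    "(\<integral>x. (norm (f x - h x))\<^sup>2 \<partial>M) < \<delta>"
proof -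
  note [measurable] = square_integrable_measurable[OF f]
  note [measurable_cong] = sets
  obtain F where F: "\<And>i. simple_function borel (F i)" "\<And>x. (\<lambda>i. F i x) \<longlonglongrightarrow> f x"
      "\<And>i x. norm (F i x) \<le> 2 * norm (f x)"
    using borel_measurable_implies_sequence_metric[OF square_integrable_measurable[OF f], of 0]
    by auto
  note [measurable] = F(1)[THEN borel_measurable_simple_function]
  have "(\<lambda>i. \<integral>x. (norm (f x - F i x))\<^sup>2 \<partial>M) \<longlonglongrightarrow> (\<integral>x. 0 \<partial>M)"
  proof (rule integral_dominated_convergence)
    show "integrable M (\<lambda>x. 9 * (norm (f x))\<^sup>2)"
      using square_integrable_integrable[OF f] by simp
    show "AE x in M. (\<lambda>i. (norm (f x - F i x))\<^sup>2) \<longlonglongrightarrow> 0"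
    proof (rule AE_I2)
      fix x
      have "(\<lambda>i. (norm (f x - F i x))\<^sup>2) \<longlonglongrightarrow> (norm (f x - f x))\<^sup>2"
        by (intro tendsto_intros F)
      then show "(\<lambda>i. (norm (f x - F i x))\<^sup>2) \<longlonglongrightarrow> 0" by simp
    qed
    show "AE x in M. norm ((norm (f x - F i x))\<^sup>2) \<le> 9 * (norm (f x))\<^sup>2" for i
    proof (rule AE_I2)
      fix x
      have "norm (f x - F i x) \<le> 3 * norm (f x)"
        using norm_triangle_ineq4[of "f x" "F i x"] F(3)[of i x] by linarith
      then have "(norm (f x - F i x))\<^sup>2 \<le> (3 * norm (f x))\<^sup>2" by (intro power_mono) auto
      then show "norm ((norm (f x - F i x))\<^sup>2) \<le> 9 * (norm (f x))\<^sup>2"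
        by (simp add: power_mult_distrib)
    qed
  qed measurable
  then have "(\<lambda>i. \<integral>x. (norm (f x - F i x))\<^sup>2 \<partial>M) \<longlonglongrightarrow> 0" by simp
  then have "\<forall>\<^sub>F i in sequentially. (\<integral>x. (norm (f x - F i x))\<^sup>2 \<partial>M) < \<delta>"
    using \<open>0 < \<delta>\<close> by (rule order_tendstoD)
  then obtain i where i: "(\<integral>x. (norm (f x - F i x))\<^sup>2 \<partial>M) < \<delta>"
    using eventually_happens'[OF sequentially_bot] by blast
  have "F i \<in> square_integrable M"
  proof (rule square_integrableI)
    show "integrable M (\<lambda>x. (norm (F i x))\<^sup>2)"
    proof (rule Bochner_Integration.integrable_bound)
      show "integrable M (\<lambda>x. 4 * (norm (f x))\<^sup>2)"
        using square_integrable_integrable[OF f] by simp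
      show "AE x in M. norm ((norm (F i x))\<^sup>2) \<le> norm (4 * (norm (f x))\<^sup>2)"
      proof (rule AE_I2)
        fix x
        have "(norm (F i x))\<^sup>2 \<le> (2 * norm (f x))\<^sup>2" using F(3) by (intro power_mono) auto
        then show "norm ((norm (F i x))\<^sup>2) \<le> norm (4 * (norm (f x))\<^sup>2)"
          by (simp add: power_mult_distrib)
      qed
    qed measurable
  qed measurable
  with that[OF F(1)] i show ?thesis by blast
qed

text \<open>
  The estimate is Young's inequality, integrated: a weighted form of the Cauchy-Schwarz inequality.
\<close>

lemma square_integrable_inner:
  fixes f g :: "'s::topological_space \<Rightarrow> 'a::{real_inner, second_countable_topology}"
  assumes "sets M = sets borel" and f: "f \<in> square_integrable M" and g: "g \<in> square_integrable M"
  shows "integrable M (\<lambda>x. f x \<bullet> g x)"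
    and "0 < c \<Longrightarrow> \<bar>\<integral>x. f x \<bullet> g x \<partial>M\<bar>
      \<le> c * (\<integral>x. (norm (f x))\<^sup>2 \<partial>M) + inverse c * (\<integral>x. (norm (g x))\<^sup>2 \<partial>M)"
proof -
  note [measurable] = f[THEN square_integrable_measurable] g[THEN square_integrable_measurable]
  note [measurable_cong] = assms(1)
  note fg = f[THEN square_integrable_integrable] g[THEN square_integrable_integrable]
  have young: "\<bar>f x \<bullet> g x\<bar> \<le> c * (norm (f x))\<^sup>2 + inverse c * (norm (g x))\<^sup>2" if "0 < c" for c x
  proof -
    have "\<bar>f x \<bullet> g x\<bar> \<le> norm (f x) * norm (g x)" by (rule Cauchy_Schwarz_ineq2)
    also have "\<dots> = (sqrt c * norm (f x)) * (inverse (sqrt c) * norm (g x))"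
      using that by (simp add: field_simps)
    also have "\<dots> \<le> (sqrt c * norm (f x))\<^sup>2 + (inverse (sqrt c) * norm (g x))\<^sup>2"
      using sum_squares_bound[of "sqrt c * norm (f x)" "inverse (sqrt c) * norm (g x)"]
        zero_le_power2[of "sqrt c * norm (f x)"] zero_le_power2[of "inverse (sqrt c) * norm (g x)"]
      by linarith
    finally show ?thesis using that by (simp add: power_mult_distrib power_inverse)
  qed
  show int: "integrable M (\<lambda>x. f x \<bullet> g x)"
  proof (rule Bochner_Integration.integrable_bound)
    show "integrable M (\<lambda>x. (norm (f x))\<^sup>2 + (norm (g x))\<^sup>2)" using fg by simp
    show "AE x in M. norm (f x \<bullet> g x) \<le> norm ((norm (f x))\<^sup>2 + (norm (g x))\<^sup>2)"
      using young[of 1] by (intro AE_I2) simp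
  qed measurable
  assume c: "0 < c"
  have "\<bar>\<integral>x. f x \<bullet> g x \<partial>M\<bar> \<le> (\<integral>x. c * (norm (f x))\<^sup>2 + inverse c * (norm (g x))\<^sup>2 \<partial>M)"
    using young[OF c] fg int by (intro integral_abs_bound[THEN order_trans] integral_mono) auto
  then show "\<bar>\<integral>x. f x \<bullet> g x \<partial>M\<bar>
      \<le> c * (\<integral>x. (norm (f x))\<^sup>2 \<partial>M) + inverse c * (\<integral>x. (norm (g x))\<^sup>2 \<partial>M)"
    using fg by simp
qed

text \<open>
  The bound \<open>\<delta>\<close> is uniform in the measure, which is what makes the approximations below uniform over
  all couplings of two given measures.
\<close>

lemma square_integrable_inner_small:
  fixes N e :: real
  assumes N: "0 \<le> N" and e: "0 < e"
  obtains \<delta> where "0 < \<delta>"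
    "\<And>(M :: 's::topological_space measure) (f :: 's \<Rightarrow> 'a::{real_inner, second_countable_topology}) g.
      sets M = sets borel \<Longrightarrow> f \<in> square_integrable M \<Longrightarrow> g \<in> square_integrable M \<Longrightarrow>
      (\<integral>x. (norm (f x))\<^sup>2 \<partial>M) < \<delta> \<Longrightarrow> (\<integral>x. (norm (g x))\<^sup>2 \<partial>M) \<le> N \<Longrightarrow>
      \<bar>\<integral>x. f x \<bullet> g x \<partial>M\<bar> < e"
proof -
  \<comment> \<open>The weight in Young's inequality is chosen to make the contribution of \<open>g\<close> at most \<open>e / 2\<close>.\<close>
  define c where "c = 2 * (N + 1) / e"
  have c: "0 < c" using N e by (simp add: c_def)
  show ?thesis
  proof (rule that)
    show "0 < e / (2 * c)" using c e by simp
    fix M :: "'s measure" and f g :: "'s \<Rightarrow> 'a"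
    assume M: "sets M = sets borel" "f \<in> square_integrable M" "g \<in> square_integrable M"
      and small: "(\<integral>x. (norm (f x))\<^sup>2 \<partial>M) < e / (2 * c)" and g: "(\<integral>x. (norm (g x))\<^sup>2 \<partial>M) \<le> N"
    have "\<bar>\<integral>x. f x \<bullet> g x \<partial>M\<bar>
        \<le> c * (\<integral>x. (norm (f x))\<^sup>2 \<partial>M) + inverse c * (\<integral>x. (norm (g x))\<^sup>2 \<partial>M)"
      by (rule square_integrable_inner(2)[OF M c])
    also have "\<dots> \<le> c * (\<integral>x. (norm (f x))\<^sup>2 \<partial>M) + inverse c * N"
      using g c by (intro add_left_mono mult_left_mono) auto
    also have "c * (\<integral>x. (norm (f x))\<^sup>2 \<partial>M) < e / 2"
      using small c by (simp add: field_simps)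
    also have "inverse c * N \<le> e / 2"
      using N e by (simp add: c_def field_simps)
    finally show "\<bar>\<integral>x. f x \<bullet> g x \<partial>M\<bar> < e" by simp
  qed
qed

section \<open>Compactness of the set of couplings\<close>

text \<open>
  Every defining equation involves finitely many coordinates, so the set is closed in a product of
  unit intervals, which is compact by Tychonoff's theorem.
\<close>

lemma compact_bimeasures: "compact (bimeasures P Q)"
proof -
  have box: "compact (PiE UNIV (\<lambda>_. {0..1}) :: ('a set \<times> 'b set \<Rightarrow> real) set)"
    using compactin_PiE[of "\<lambda>_. euclidean" UNIV "\<lambda>_::'a set \<times> 'b set. {0..1::real}"]
    by (simp add: euclidean_product_topology)
  have [continuous_intros]: "continuous_on UNIV (\<lambda>b :: 'a set \<times> 'b set \<Rightarrow> real. b i)" for i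
    by simp
  have closed: "closed ((\<Inter>A\<in>sets borel. \<Inter>A'\<in>sets borel. \<Inter>B\<in>sets borel.
        {b. A \<inter> A' = {} \<longrightarrow> b (A \<union> A', B) = b (A, B) + b (A', B)})
      \<inter> (\<Inter>A\<in>sets borel. \<Inter>B\<in>sets borel. \<Inter>B'\<in>sets borel.
        {b. B \<inter> B' = {} \<longrightarrow> b (A, B \<union> B') = b (A, B) + b (A, B')})
      \<inter> (\<Inter>A\<in>sets borel. {b. b (A, UNIV) = measure P A})
      \<inter> (\<Inter>B\<in>sets borel. {b. b (UNIV, B) = measure Q B}))" (is "closed ?C")
    by (intro closed_Int closed_INT ballI closed_Collect_imp open_Collect_const closed_Collect_eq
        continuous_intros)
  have "b \<in> PiE UNIV (\<lambda>_. {0..1}) \<longleftrightarrow> (\<forall>A B. 0 \<le> b (A, B) \<and> b (A, B) \<le> 1)"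
    for b :: "'a set \<times> 'b set \<Rightarrow> real"
    by (simp add: PiE_UNIV_domain Pi_iff)
  then have "bimeasures P Q = PiE UNIV (\<lambda>_. {0..1}) \<inter> ?C"
    unfolding bimeasures_def by (intro set_eqI) (simp only: Int_iff INT_iff mem_Collect_eq conj_assoc)
  with compact_Int_closed[OF box closed] show ?thesis by simp
qed

lemma couplings_prob_space: "G \<in> couplings P Q \<Longrightarrow> prob_space G"
  and couplings_sets: "G \<in> couplings P Q \<Longrightarrow> sets G = sets borel"
  and couplings_fst: "G \<in> couplings P Q \<Longrightarrow> distr G borel fst = P"
  and couplings_snd: "G \<in> couplings P Q \<Longrightarrow> distr G borel snd = Q"
  by (auto simp: couplings_def)

lemma couplings_sets_pair:
  fixes P :: "'s::second_countable_topology measure" and Q :: "'t::second_countable_topology measure"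
  shows "G \<in> couplings P Q \<Longrightarrow> sets G = sets (borel \<Otimes>\<^sub>M borel)"
  using couplings_sets sets_borel_prod by blast

lemma couplings_space: "G \<in> couplings P Q \<Longrightarrow> space G = UNIV"
  using sets_eq_imp_space_eq[OF couplings_sets] by simp

lemma bimeasure_of_coupling:
  fixes P :: "'s::second_countable_topology measure" and Q :: "'t::second_countable_topology measure"
  assumes G: "G \<in> couplings P Q"
  shows "(\<lambda>(A, B). measure G (A \<times> B)) \<in> bimeasures P Q"
proof -
  interpret G: prob_space G by (rule couplings_prob_space[OF G])
  note [measurable_cong] = couplings_sets_pair[OF G]
  have "measure G (A \<times> UNIV) = measure P A" if [measurable]: "A \<in> sets borel" for A
    unfolding couplings_fst[OF G, symmetric]
    by (subst measure_distr) (auto simp: couplings_space[OF G] intro!: arg_cong[where f="measure G"])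
  moreover have "measure G (UNIV \<times> B) = measure Q B" if [measurable]: "B \<in> sets borel" for B
    unfolding couplings_snd[OF G, symmetric]
    by (subst measure_distr) (auto simp: couplings_space[OF G] intro!: arg_cong[where f="measure G"])
  moreover have rect: "A \<times> B \<in> sets G" if "A \<in> sets borel" "B \<in> sets borel" for A B
    using that by (simp add: couplings_sets_pair[OF G])
  have "measure G ((A \<union> A') \<times> B) = measure G (A \<times> B) + measure G (A' \<times> B)"
    if "A \<in> sets borel" "A' \<in> sets borel" "B \<in> sets borel" "A \<inter> A' = {}" for A A' B
    unfolding Sigma_Un_distrib1 using that by (intro G.finite_measure_Union rect) auto
  moreover have "measure G (A \<times> (B \<union> B')) = measure G (A \<times> B) + measure G (A \<times> B')"
    if "A \<in> sets borel" "B \<in> sets borel" "B' \<in> sets borel" "B \<inter> B' = {}" for A B B'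
    unfolding Sigma_Un_distrib2 using that by (intro G.finite_measure_Union rect) auto
  ultimately show ?thesis by (simp add: bimeasures_def)
qed

text \<open>
  The coupling that extends a given bimeasure. It exists by \<open>polish_bimeasure.ex_coupling\<close> and is
  unique because rectangles generate the Borel sets of the product.
\<close>

definition coupling_of ::
    "'s::topological_space measure \<Rightarrow> 't::topological_space measure \<Rightarrow> ('s set \<times> 't set \<Rightarrow> real) \<Rightarrow> ('s \<times> 't) measure"
  where "coupling_of P Q b = (SOME G. G \<in> couplings P Q \<and>
     (\<forall>A\<in>sets borel. \<forall>B\<in>sets borel. measure G (A \<times> B) = b (A, B)))"

context polish_marginals
begin

lemma
  assumes "b \<in> bimeasures P Q"
  shows coupling_of_couplings: "coupling_of P Q b \<in> couplings P Q"
    and measure_coupling_of: "A \<in> sets borel \<Longrightarrow> B \<in> sets borel \<Longrightarrow>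
      measure (coupling_of P Q b) (A \<times> B) = b (A, B)"
proof -
  interpret polish_bimeasure P Q b by unfold_locales (rule assms)
  obtain G where "G \<in> couplings P Q"
    "\<And>A B. A \<in> sets borel \<Longrightarrow> B \<in> sets borel \<Longrightarrow> measure G (A \<times> B) = b (A, B)"
    using ex_coupling by metis
  then have "\<exists>G. G \<in> couplings P Q \<and>
      (\<forall>A\<in>sets borel. \<forall>B\<in>sets borel. measure G (A \<times> B) = b (A, B))"
    by blast
  from someI_ex[OF this]
  have *: "coupling_of P Q b \<in> couplings P Q \<and>
      (\<forall>A\<in>sets borel. \<forall>B\<in>sets borel. measure (coupling_of P Q b) (A \<times> B) = b (A, B))"
    unfolding coupling_of_def .
  show "coupling_of P Q b \<in> couplings P Q" using * by blast
  show "A \<in> sets borel \<Longrightarrow> B \<in> sets borel \<Longrightarrow> measure (coupling_of P Q b) (A \<times> B) = b (A, B)"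
    using * by blast
qed

lemma couplings_eq_image: "couplings P Q = coupling_of P Q ` bimeasures P Q"
proof (intro equalityI subsetI)
  fix G assume G: "G \<in> couplings P Q"
  let ?b = "\<lambda>(A, B). measure G (A \<times> B)"
  have b: "?b \<in> bimeasures P Q" by (rule bimeasure_of_coupling[OF G])
  note G' = coupling_of_couplings[OF b]
  have "coupling_of P Q ?b = G"
    by (rule measure_eqI_borel_rectangles)
      (auto simp: measure_coupling_of[OF b] couplings_sets[OF G] couplings_sets[OF G']
        intro!: prob_space.finite_measure couplings_prob_space[OF G] couplings_prob_space[OF G'])
  then show "G \<in> coupling_of P Q ` bimeasures P Q" using imageI[OF b, of "coupling_of P Q"] by simp
next
  fix G assume "G \<in> coupling_of P Q ` bimeasures P Q"
  then show "G \<in> couplings P Q" by (auto simp: coupling_of_couplings)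
qed

lemma integral_fst:
  fixes f :: "'s \<Rightarrow> real"
  assumes G: "G \<in> couplings P Q" and f[measurable]: "f \<in> borel_measurable borel"
  shows "(\<integral>z. f (fst z) \<partial>G) = (\<integral>x. f x \<partial>P)"
proof -
  note [measurable_cong] = couplings_sets_pair[OF G]
  show ?thesis unfolding couplings_fst[OF G, symmetric] by (subst integral_distr) auto
qed

lemma integral_snd:
  fixes g :: "'t \<Rightarrow> real"
  assumes G: "G \<in> couplings P Q" and g[measurable]: "g \<in> borel_measurable borel"
  shows "(\<integral>z. g (snd z) \<partial>G) = (\<integral>y. g y \<partial>Q)"
proof -
  note [measurable_cong] = couplings_sets_pair[OF G]
  show ?thesis unfolding couplings_snd[OF G, symmetric] by (subst integral_distr) auto
qed

end

lemma square_integrable_coupling: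
  fixes f :: "'s::second_countable_topology \<Rightarrow> 'a::{real_normed_vector, second_countable_topology}"
    and g :: "'t::second_countable_topology \<Rightarrow> 'a"
  assumes G: "G \<in> couplings P Q"
  shows square_integrable_fst: "f \<in> square_integrable P \<Longrightarrow> (\<lambda>z. f (fst z)) \<in> square_integrable G"
    and square_integrable_snd: "g \<in> square_integrable Q \<Longrightarrow> (\<lambda>z. g (snd z)) \<in> square_integrable G"
proof -
  note [measurable_cong] = couplings_sets_pair[OF G]
  have [measurable]: "fst \<in> borel_measurable (borel :: ('s \<times> 't) measure)"
    "snd \<in> borel_measurable (borel :: ('s \<times> 't) measure)"
    by (simp_all add: borel_measurable_continuous_onI continuous_on_fst continuous_on_snd)
  { assume f: "f \<in> square_integrable P"
    note [measurable] = square_integrable_measurable[OF f]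
    show "(\<lambda>z. f (fst z)) \<in> square_integrable G"
      using square_integrable_integrable[OF f]
      unfolding couplings_fst[OF G, symmetric]
      by (intro square_integrableI) (simp_all add: integrable_distr_eq) }
  { assume g: "g \<in> square_integrable Q"
    note [measurable] = square_integrable_measurable[OF g]
    show "(\<lambda>z. g (snd z)) \<in> square_integrable G"
      using square_integrable_integrable[OF g]
      unfolding couplings_snd[OF G, symmetric]
      by (intro square_integrableI) (simp_all add: integrable_distr_eq) }
qed

lemma borel_measurable_simple_preimage:
  "simple_function borel h \<Longrightarrow> h -` {c} \<in> sets borel"
  using simple_functionD(2)[of borel h "{c}"] by simp

context polish_marginals
begin

text \<open>
  For simple functions the integral is a finite linear combination of values on rectangles, hence of
  coordinates of the bimeasure.
\<close>

lemma integral_simple_inner: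
  fixes h :: "'s \<Rightarrow> 'a::{real_inner, second_countable_topology}" and k :: "'t \<Rightarrow> 'a"
  assumes h: "simple_function borel h" and k: "simple_function borel k" and G: "G \<in> couplings P Q"
  shows "(\<integral>z. h (fst z) \<bullet> k (snd z) \<partial>G)
    = (\<Sum>c\<in>range h. \<Sum>d\<in>range k. c \<bullet> d * measure G (h -` {c} \<times> k -` {d}))"
proof -
  interpret G: prob_space G by (rule couplings_prob_space[OF G])
  have fin: "finite (range h)" "finite (range k)"
    using simple_functionD(1)[OF h] simple_functionD(1)[OF k] by simp_all
  have rect: "h -` {c} \<times> k -` {d} \<in> sets G" for c d
    unfolding couplings_sets_pair[OF G]
    by (intro pair_measureI borel_measurable_simple_preimage h k)
  have "h (fst z) \<bullet> k (snd z)
      = (\<Sum>c\<in>range h. \<Sum>d\<in>range k. c \<bullet> d * indicator (h -` {c} \<times> k -` {d}) z)" for z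
  proof -
    have "(\<Sum>c\<in>range h. \<Sum>d\<in>range k. c \<bullet> d * indicator (h -` {c} \<times> k -` {d}) z)
        = (\<Sum>c\<in>range h. if h (fst z) = c then (\<Sum>d\<in>range k. if k (snd z) = d then c \<bullet> d else 0) else 0)"
      by (intro sum.cong refl) (auto simp: indicator_def mem_Times_iff intro!: sum.cong sum.neutral)
    also have "\<dots> = h (fst z) \<bullet> k (snd z)"
      using fin by (simp add: sum.delta')
    finally show ?thesis by simp
  qed
  then have "(\<integral>z. h (fst z) \<bullet> k (snd z) \<partial>G)
      = (\<integral>z. (\<Sum>c\<in>range h. \<Sum>d\<in>range k. c \<bullet> d * indicator (h -` {c} \<times> k -` {d}) z) \<partial>G)"
    by simp
  also have "\<dots> = (\<Sum>c\<in>range h. \<Sum>d\<in>range k. c \<bullet> d * measure G (h -` {c} \<times> k -` {d}))"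
    using rect by (subst Bochner_Integration.integral_sum;
        (intro Bochner_Integration.integrable_sum integrable_mult_right integrable_real_indicator)?)
      (auto simp: Bochner_Integration.integral_sum G.emeasure_eq_measure integrable_real_indicator
        couplings_space[OF G] intro!: sum.cong)
  finally show ?thesis .
qed

lemma square_integrable_norm_integral:
  assumes G: "G \<in> couplings P Q"
  shows integral_norm_fst: "f \<in> square_integrable P \<Longrightarrow>
      (\<integral>z. (norm (f (fst z)))\<^sup>2 \<partial>G) = (\<integral>x. (norm (f x))\<^sup>2 \<partial>P)"
    and integral_norm_snd: "g \<in> square_integrable Q \<Longrightarrow>
      (\<integral>z. (norm (g (snd z)))\<^sup>2 \<partial>G) = (\<integral>y. (norm (g y))\<^sup>2 \<partial>Q)"
proof -
  assume f: "f \<in> square_integrable P"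
  note [measurable] = square_integrable_measurable[OF f]
  show "(\<integral>z. (norm (f (fst z)))\<^sup>2 \<partial>G) = (\<integral>x. (norm (f x))\<^sup>2 \<partial>P)"
    by (rule integral_fst[OF G]) measurable
next
  assume g: "g \<in> square_integrable Q"
  note [measurable] = square_integrable_measurable[OF g]
  show "(\<integral>z. (norm (g (snd z)))\<^sup>2 \<partial>G) = (\<integral>y. (norm (g y))\<^sup>2 \<partial>Q)"
    by (rule integral_snd[OF G]) measurable
qed

text \<open>
  For simple functions in place of \<open>f\<close> and \<open>g\<close>, the integral is a finite sum of coordinates and
  thus continuous. The general case is a uniform limit of such functions: the error made by replacing
  \<open>f\<close> and \<open>g\<close> with simple approximations depends on the coupling only through its marginals, which
  are fixed.
\<close>

lemma continuous_on_integral_inner: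
  fixes f :: "'s \<Rightarrow> 'a::{real_inner, second_countable_topology}" and g :: "'t \<Rightarrow> 'a"
  assumes f: "f \<in> square_integrable P" and g: "g \<in> square_integrable Q"
  shows "continuous_on (bimeasures P Q) (\<lambda>b. \<integral>z. f (fst z) \<bullet> g (snd z) \<partial>coupling_of P Q b)"
proof -
  have approx: "\<exists>\<phi>. continuous_on UNIV \<phi> \<and>
      (\<forall>b\<in>bimeasures P Q. \<bar>(\<integral>z. f (fst z) \<bullet> g (snd z) \<partial>coupling_of P Q b) - \<phi> b\<bar> < e)"
    if e: "0 < e" for e :: real
  proof -
    have e2: "0 < e / 2" using e by simp
    \<comment> \<open>First \<open>h\<close> is chosen close to \<open>f\<close> relative to the norm of \<open>g\<close>,
        then \<open>k\<close> close to \<open>g\<close> relative to the norm of \<open>h\<close>.\<close>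
    have norms_nonneg: "0 \<le> (\<integral>y. (norm (g y))\<^sup>2 \<partial>Q)" "0 \<le> (\<integral>x. (norm (h x))\<^sup>2 \<partial>P)"
      for h :: "'s \<Rightarrow> 'a"
      by simp_all
    obtain \<delta> where \<delta>: "0 < \<delta>"
      "\<And>(M :: ('s \<times> 't) measure) (u :: 's \<times> 't \<Rightarrow> 'a) w.
        sets M = sets borel \<Longrightarrow> u \<in> square_integrable M \<Longrightarrow> w \<in> square_integrable M \<Longrightarrow>
        (\<integral>z. (norm (u z))\<^sup>2 \<partial>M) < \<delta> \<Longrightarrow> (\<integral>z. (norm (w z))\<^sup>2 \<partial>M) \<le> (\<integral>y. (norm (g y))\<^sup>2 \<partial>Q) \<Longrightarrow>
        \<bar>\<integral>z. u z \<bullet> w z \<partial>M\<bar> < e / 2"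
      using square_integrable_inner_small[OF norms_nonneg(1) e2] by blast
    obtain h where h: "simple_function borel h" "h \<in> square_integrable P"
      "(\<integral>x. (norm (f x - h x))\<^sup>2 \<partial>P) < \<delta>"
      using square_integrable_simple_approx[OF sets_P f \<delta>(1)] by blast
    obtain \<eta> where \<eta>: "0 < \<eta>"
      "\<And>(M :: ('s \<times> 't) measure) (u :: 's \<times> 't \<Rightarrow> 'a) w.
        sets M = sets borel \<Longrightarrow> u \<in> square_integrable M \<Longrightarrow> w \<in> square_integrable M \<Longrightarrow>
        (\<integral>z. (norm (u z))\<^sup>2 \<partial>M) < \<eta> \<Longrightarrow> (\<integral>z. (norm (w z))\<^sup>2 \<partial>M) \<le> (\<integral>x. (norm (h x))\<^sup>2 \<partial>P) \<Longrightarrow>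
        \<bar>\<integral>z. u z \<bullet> w z \<partial>M\<bar> < e / 2"
      using square_integrable_inner_small[OF norms_nonneg(2) e2] by blast
    obtain k where k: "simple_function borel k" "k \<in> square_integrable Q"
      "(\<integral>x. (norm (g x - k x))\<^sup>2 \<partial>Q) < \<eta>"
      using square_integrable_simple_approx[OF sets_Q g \<eta>(1)] by blast
    define \<phi> where "\<phi> b = (\<Sum>c\<in>range h. \<Sum>d\<in>range k. c \<bullet> d * b (h -` {c}, k -` {d}))"
      for b :: "'s set \<times> 't set \<Rightarrow> real"
    have "continuous_on UNIV \<phi>"
      unfolding \<phi>_def by (intro continuous_intros continuous_on_product_coordinates)
    moreover have "\<bar>(\<integral>z. f (fst z) \<bullet> g (snd z) \<partial>coupling_of P Q b) - \<phi> b\<bar> < e"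
      if b: "b \<in> bimeasures P Q" for b
    proof -
      let ?G = "coupling_of P Q b"
      note G = coupling_of_couplings[OF b]
      have fh: "(\<lambda>x. f x - h x) \<in> square_integrable P"
        using square_integrable_add_scaleR[OF sets_P f h(2), of "-1"] by simp
      have gk: "(\<lambda>y. g y - k y) \<in> square_integrable Q"
        using square_integrable_add_scaleR[OF sets_Q g k(2), of "-1"] by simp
      note int = square_integrable_inner(1)[OF couplings_sets[OF G] square_integrable_fst[OF G]
          square_integrable_snd[OF G]]
      have "\<phi> b = (\<integral>z. h (fst z) \<bullet> k (snd z) \<partial>?G)"
        unfolding \<phi>_def integral_simple_inner[OF h(1) k(1) G]
        by (simp add: measure_coupling_of[OF b] borel_measurable_simple_preimage h(1) k(1))
      also have "\<dots> = (\<integral>z. f (fst z) \<bullet> g (snd z) \<partial>?G)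
          - (\<integral>z. (f (fst z) - h (fst z)) \<bullet> g (snd z) \<partial>?G)
          - (\<integral>z. h (fst z) \<bullet> (g (snd z) - k (snd z)) \<partial>?G)"
        using int[OF f g] int[OF h(2) g] int[OF h(2) k(2)]
        by (simp add: inner_diff_left inner_diff_right)
      moreover have "\<bar>\<integral>z. (f (fst z) - h (fst z)) \<bullet> g (snd z) \<partial>?G\<bar> < e / 2"
        using h(3) integral_norm_fst[OF G fh] integral_norm_snd[OF G g]
        by (intro \<delta>(2) couplings_sets[OF G] square_integrable_fst[OF G fh] square_integrable_snd[OF G g]) simp_all
      moreover have "\<bar>\<integral>z. (g (snd z) - k (snd z)) \<bullet> h (fst z) \<partial>?G\<bar> < e / 2"
        using k(3) integral_norm_snd[OF G gk] integral_norm_fst[OF G h(2)]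
        by (intro \<eta>(2) couplings_sets[OF G] square_integrable_snd[OF G gk] square_integrable_fst[OF G h(2)]) simp_all
      then have "\<bar>\<integral>z. h (fst z) \<bullet> (g (snd z) - k (snd z)) \<partial>?G\<bar> < e / 2"
        by (simp add: inner_commute)
      ultimately show ?thesis by linarith
    qed
    ultimately show ?thesis by blast
  qed
  then have "\<forall>n. \<exists>\<phi>. continuous_on UNIV \<phi> \<and> (\<forall>b\<in>bimeasures P Q.
      \<bar>(\<integral>z. f (fst z) \<bullet> g (snd z) \<partial>coupling_of P Q b) - \<phi> b\<bar> < inverse (Suc n))"
    by simp
  then obtain \<phi> where cont: "\<And>n. continuous_on UNIV (\<phi> n)"
    and \<phi>: "\<And>n b. b \<in> bimeasures P Q \<Longrightarrow>
      \<bar>(\<integral>z. f (fst z) \<bullet> g (snd z) \<partial>coupling_of P Q b) - \<phi> n b\<bar> < inverse (Suc n)"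
    by metis
  show ?thesis
  proof (rule uniform_limit_theorem)
    show "\<forall>\<^sub>F n in sequentially. continuous_on (bimeasures P Q) (\<phi> n)"
      using continuous_on_subset[OF cont subset_UNIV] by simp
    show "uniform_limit (bimeasures P Q) \<phi>
        (\<lambda>b. \<integral>z. f (fst z) \<bullet> g (snd z) \<partial>coupling_of P Q b) sequentially"
    proof (rule uniform_limitI)
      fix e :: real assume "0 < e"
      have "\<forall>\<^sub>F n in sequentially. inverse (real (Suc n)) < e"
        using LIMSEQ_inverse_real_of_nat \<open>0 < e\<close> by (rule order_tendstoD)
      then show "\<forall>\<^sub>F n in sequentially. \<forall>b\<in>bimeasures P Q.
          dist (\<phi> n b) (\<integral>z. f (fst z) \<bullet> g (snd z) \<partial>coupling_of P Q b) < e"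
      proof eventually_elim
        case (elim n)
        show ?case
        proof
          fix b assume "b \<in> bimeasures P Q"
          from \<phi>[OF this, of n] elim
          show "dist (\<phi> n b) (\<integral>z. f (fst z) \<bullet> g (snd z) \<partial>coupling_of P Q b) < e"
            unfolding dist_real_def by linarith
        qed
      qed
    qed
  qed simp
qed

lemma
  fixes a p :: "'s \<Rightarrow> 'a::{real_inner, second_countable_topology}" and b q :: "'t \<Rightarrow> 'a"
  assumes ap: "a \<in> square_integrable P" "p \<in> square_integrable P"
    and bq: "b \<in> square_integrable Q" "q \<in> square_integrable Q" and G: "G \<in> couplings P Q"
  shows integrable_inner_diff: "integrable G (\<lambda>z. (a (fst z) - b (snd z)) \<bullet> (p (fst z) - q (snd z)))"
    and integral_inner_diff: "(\<integral>z. (a (fst z) - b (snd z)) \<bullet> (p (fst z) - q (snd z)) \<partial>G)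
      = (\<integral>x. a x \<bullet> p x \<partial>P) + (\<integral>y. b y \<bullet> q y \<partial>Q)
        - (\<integral>z. a (fst z) \<bullet> q (snd z) \<partial>G) - (\<integral>z. p (fst z) \<bullet> b (snd z) \<partial>G)"
proof -
  note [measurable] = ap[THEN square_integrable_measurable] bq[THEN square_integrable_measurable]
  note int = square_integrable_inner(1)[OF couplings_sets[OF G]]
  note int' = int[OF square_integrable_fst[OF G ap(1)] square_integrable_fst[OF G ap(2)]]
    int[OF square_integrable_fst[OF G ap(1)] square_integrable_snd[OF G bq(2)]]
    int[OF square_integrable_fst[OF G ap(2)] square_integrable_snd[OF G bq(1)]]
    int[OF square_integrable_snd[OF G bq(1)] square_integrable_snd[OF G bq(2)]]
  have expand: "(a (fst z) - b (snd z)) \<bullet> (p (fst z) - q (snd z))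
      = a (fst z) \<bullet> p (fst z) + b (snd z) \<bullet> q (snd z)
        - a (fst z) \<bullet> q (snd z) - p (fst z) \<bullet> b (snd z)" for z
    by (simp add: inner_diff_left inner_diff_right inner_commute)
  show "integrable G (\<lambda>z. (a (fst z) - b (snd z)) \<bullet> (p (fst z) - q (snd z)))"
    unfolding expand using int' by simp
  have "(\<integral>z. a (fst z) \<bullet> p (fst z) \<partial>G) = (\<integral>x. a x \<bullet> p x \<partial>P)"
    by (rule integral_fst[OF G]) measurable
  moreover have "(\<integral>z. b (snd z) \<bullet> q (snd z) \<partial>G) = (\<integral>y. b y \<bullet> q y \<partial>Q)"
    by (rule integral_snd[OF G]) measurable
  ultimately show "(\<integral>z. (a (fst z) - b (snd z)) \<bullet> (p (fst z) - q (snd z)) \<partial>G)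
      = (\<integral>x. a x \<bullet> p x \<partial>P) + (\<integral>y. b y \<bullet> q y \<partial>Q)
        - (\<integral>z. a (fst z) \<bullet> q (snd z) \<partial>G) - (\<integral>z. p (fst z) \<bullet> b (snd z) \<partial>G)"
    unfolding expand using int' by simp
qed

text \<open>
  The independent coupling, in the form of its bimeasure.
\<close>

lemma couplings_nonempty: "couplings P Q \<noteq> {}"
proof -
  let ?b = "\<lambda>(A, B). measure P A * measure Q B"
  have "?b \<in> bimeasures P Q"
    using P.prob_space Q.prob_space
    by (auto simp: bimeasures_def space_P space_Q sets_P sets_Q P.finite_measure_Union
        Q.finite_measure_Union algebra_simps intro!: mult_le_one)
  then show ?thesis using coupling_of_couplings by blast
qed

text \<open>
  The products expand into terms that depend on the marginals alone and mixed terms of the form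
  treated in \<open>continuous_on_integral_inner\<close>. The image of the couplings is therefore a continuous
  image of the compact set of bimeasures.
\<close>

theorem compact_integral_inner_diff:
  fixes a p a' p' :: "'s \<Rightarrow> 'a::{real_inner, second_countable_topology}" and b q b' q' :: "'t \<Rightarrow> 'a"
  assumes ap: "a \<in> square_integrable P" "p \<in> square_integrable P"
    and bq: "b \<in> square_integrable Q" "q \<in> square_integrable Q"
    and ap': "a' \<in> square_integrable P" "p' \<in> square_integrable P"
    and bq': "b' \<in> square_integrable Q" "q' \<in> square_integrable Q"
  shows "compact ((\<lambda>G. (\<integral>z. (a (fst z) - b (snd z)) \<bullet> (p (fst z) - q (snd z)) \<partial>G,
    \<integral>z. (a' (fst z) - b' (snd z)) \<bullet> (p' (fst z) - q' (snd z)) \<partial>G)) ` couplings P Q)"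
proof -
  have cont: "continuous_on (bimeasures P Q)
      (\<lambda>\<beta>. \<integral>z. (a (fst z) - b (snd z)) \<bullet> (p (fst z) - q (snd z)) \<partial>coupling_of P Q \<beta>)"
    if ap: "a \<in> square_integrable P" "p \<in> square_integrable P"
      and bq: "b \<in> square_integrable Q" "q \<in> square_integrable Q"
    for a p :: "'s \<Rightarrow> 'a" and b q :: "'t \<Rightarrow> 'a"
  proof (rule continuous_on_eq)
    show "continuous_on (bimeasures P Q) (\<lambda>\<beta>. (\<integral>x. a x \<bullet> p x \<partial>P) + (\<integral>y. b y \<bullet> q y \<partial>Q)
        - (\<integral>z. a (fst z) \<bullet> q (snd z) \<partial>coupling_of P Q \<beta>)
        - (\<integral>z. p (fst z) \<bullet> b (snd z) \<partial>coupling_of P Q \<beta>))"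
      by (intro continuous_intros continuous_on_integral_inner ap bq)
  qed (simp add: integral_inner_diff[OF ap bq] coupling_of_couplings)
  show ?thesis
    unfolding couplings_eq_image image_image
    by (intro compact_continuous_image compact_bimeasures continuous_on_Pair cont
        ap bq ap' bq')
qed

end

section \<open>Lifting couplings along maps\<close>

lemma couplings_distr:
  fixes P :: "'s::second_countable_topology measure" and Q :: "'t::second_countable_topology measure"
    and f :: "'s \<Rightarrow> 'x::second_countable_topology" and g :: "'t \<Rightarrow> 'y::second_countable_topology"
  assumes G: "G \<in> couplings P Q"
    and f[measurable]: "f \<in> borel_measurable borel" and g[measurable]: "g \<in> borel_measurable borel"
  shows "distr G borel (\<lambda>z. (f (fst z), g (snd z))) \<in> couplings (distr P borel f) (distr Q borel g)"
proof -
  interpret G: prob_space G by (rule couplings_prob_space[OF G])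
  note [measurable_cong] = couplings_sets_pair[OF G]
  have fg: "(\<lambda>z. (f (fst z), g (snd z))) \<in> measurable G borel"
    unfolding borel_prod[symmetric] by measurable
  have [measurable]: "fst \<in> borel_measurable (borel :: ('x \<times> 'y) measure)"
    "snd \<in> borel_measurable (borel :: ('x \<times> 'y) measure)"
    by (simp_all add: borel_measurable_continuous_onI continuous_on_fst continuous_on_snd)
  have "prob_space (distr G borel (\<lambda>z. (f (fst z), g (snd z))))"
    by (rule G.prob_space_distr[OF fg])
  moreover have "distr (distr G borel (\<lambda>z. (f (fst z), g (snd z)))) borel fst = distr P borel f"
    using fg unfolding couplings_fst[OF G, symmetric]
    by (simp add: distr_distr comp_def)
  moreover have "distr (distr G borel (\<lambda>z. (f (fst z), g (snd z)))) borel snd = distr Q borel g"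
    using fg unfolding couplings_snd[OF G, symmetric]
    by (simp add: distr_distr comp_def)
  ultimately show ?thesis by (simp add: couplings_def)
qed

lemma couplings_swap:
  fixes P :: "'s::second_countable_topology measure" and Q :: "'t::second_countable_topology measure"
  assumes G: "G \<in> couplings P Q"
  shows "distr G borel prod.swap \<in> couplings Q P"
proof -
  interpret G: prob_space G by (rule couplings_prob_space[OF G])
  note [measurable_cong] = couplings_sets_pair[OF G]
  have swap: "prod.swap \<in> measurable G borel"
    unfolding borel_prod[symmetric] prod.swap_def by measurable
  have [measurable]: "fst \<in> borel_measurable (borel :: ('t \<times> 's) measure)"
    "snd \<in> borel_measurable (borel :: ('t \<times> 's) measure)"
    by (simp_all add: borel_measurable_continuous_onI continuous_on_fst continuous_on_snd)
  have "prob_space (distr G borel prod.swap)" by (rule G.prob_space_distr[OF swap])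
  moreover have "distr (distr G borel prod.swap) borel fst = Q"
    using swap by (simp add: distr_distr comp_def couplings_snd[OF G])
  moreover have "distr (distr G borel prod.swap) borel snd = P"
    using swap by (simp add: distr_distr comp_def couplings_fst[OF G])
  ultimately show ?thesis by (simp add: couplings_def)
qed

text \<open>
  In probabilistic terms, the second component of \<open>\<gamma>\<close> is drawn conditionally on \<open>f\<close> and independently
  of the rest of \<open>P\<close>. For each Borel set \<open>B\<close>, the conditional probability of \<open>B\<close> given the first
  component is a Radon-Nikodym density \<open>h B\<close>. These densities add up almost everywhere for each pair
  of disjoint sets \<open>B\<close>, with an exceptional null set that may depend on the pair; this is enough for
  the integrals of \<open>h B \<circ> f\<close> over \<open>A\<close> to form a bimeasure, and its extension to a coupling takes the
  place of a disintegration of \<open>\<gamma>\<close>.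
\<close>

lemma (in polish_marginals) lift_coupling_left:
  fixes f :: "'s \<Rightarrow> 'x::{second_countable_topology, complete_space}"
  assumes f[measurable]: "f \<in> borel_measurable borel" and \<gamma>: "\<gamma> \<in> couplings (distr P borel f) Q"
  obtains G where "G \<in> couplings P Q" "distr G borel (\<lambda>z. (f (fst z), snd z)) = \<gamma>"
proof -
  note [measurable_cong] = sets_P sets_Q
  define \<mu> where "\<mu> = distr P borel f"
  have sets_\<mu>[measurable_cong]: "sets \<mu> = sets borel" by (simp add: \<mu>_def)
  interpret \<mu>: prob_space \<mu> unfolding \<mu>_def by (rule P.prob_space_distr) measurable
  interpret \<gamma>: prob_space \<gamma> by (rule couplings_prob_space[OF \<gamma>])
  note [measurable_cong] = couplings_sets_pair[OF \<gamma>]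
  have rect[measurable]: "C \<times> B \<in> sets \<gamma>" if "C \<in> sets borel" "B \<in> sets borel" for C B
    using that by (simp add: couplings_sets_pair[OF \<gamma>])
  define slice where "slice B = distr (density \<gamma> (indicator (UNIV \<times> B))) borel fst" for B
  have emeasure_slice: "emeasure (slice B) C = emeasure \<gamma> (C \<times> B)"
    if [measurable]: "B \<in> sets borel" "C \<in> sets borel" for B C
  proof -
    have "emeasure (slice B) C = emeasure (density \<gamma> (indicator (UNIV \<times> B))) (C \<times> UNIV)"
      unfolding slice_def
      by (subst emeasure_distr) (auto simp: couplings_space[OF \<gamma>] intro!: arg_cong2[where f=emeasure])
    also have "\<dots> = (\<integral>\<^sup>+z. indicator (UNIV \<times> B) z * indicator (C \<times> UNIV) z \<partial>\<gamma>)"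
      by (rule emeasure_density) auto
    also have "\<dots> = (\<integral>\<^sup>+z. indicator (C \<times> B) z \<partial>\<gamma>)"
      by (intro nn_integral_cong) (auto split: split_indicator)
    also have "\<dots> = emeasure \<gamma> (C \<times> B)" by simp
    finally show ?thesis .
  qed
  define h where "h B = RN_deriv \<mu> (slice B)" for B
  have h_meas: "h B \<in> borel_measurable \<mu>" for B unfolding h_def by measurable
  have h_meas'[measurable]: "h B \<in> borel_measurable borel" for B
    using h_meas[of B] by (simp add: measurable_cong_sets[OF sets_\<mu> refl])
  have density_h: "density \<mu> (h B) = slice B" if B: "B \<in> sets borel" for B
  proof -
    have "emeasure (slice B) C = 0" if "C \<in> sets borel" "emeasure \<mu> C = 0" for C
    proof -
      have "emeasure \<mu> C = emeasure \<gamma> (C \<times> UNIV)"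
        unfolding \<mu>_def couplings_fst[OF \<gamma>, symmetric] using that(1)
        by (subst emeasure_distr) (auto simp: couplings_space[OF \<gamma>] intro!: arg_cong[where f="emeasure \<gamma>"])
      moreover have "emeasure \<gamma> (C \<times> B) \<le> emeasure \<gamma> (C \<times> UNIV)"
        using that(1) by (intro emeasure_mono rect) auto
      ultimately show ?thesis using that B by (simp add: emeasure_slice)
    qed
    then have "absolutely_continuous \<mu> (slice B)"
      by (auto simp: absolutely_continuous_def null_sets_def slice_def sets_\<mu>)
    then show ?thesis
      unfolding h_def by (rule \<mu>.density_RN_deriv) (simp add: slice_def sets_\<mu>)
  qed
  have h_integral: "(\<integral>\<^sup>+z. h B (f z) * indicator (f -` C) z \<partial>P) = emeasure \<gamma> (C \<times> B)"
    if [measurable]: "B \<in> sets borel" "C \<in> sets borel" for B C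
  proof -
    have "(\<integral>\<^sup>+z. h B (f z) * indicator (f -` C) z \<partial>P) = (\<integral>\<^sup>+x. h B x * indicator C x \<partial>\<mu>)"
      unfolding \<mu>_def by (subst nn_integral_distr) (auto intro!: nn_integral_cong simp: indicator_def)
    also have "\<dots> = emeasure (density \<mu> (h B)) C"
      by (subst emeasure_density) auto
    finally show ?thesis by (simp add: density_h emeasure_slice)
  qed
  define R where "R B = density P (\<lambda>z. h B (f z))" for B
  have sets_R: "sets (R B) = sets borel" and space_R: "space (R B) = UNIV" for B
    by (simp_all add: R_def sets_P space_P)
  have R: "emeasure (R B) A = (\<integral>\<^sup>+z. h B (f z) * indicator A z \<partial>P)" if "A \<in> sets borel" for A B
    using that unfolding R_def by (subst emeasure_density) auto
  have R_preimage: "emeasure (R B) (f -` C) = emeasure \<gamma> (C \<times> B)"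
    if "B \<in> sets borel" "C \<in> sets borel" for B C
  proof -
    have "f -` C \<in> sets borel" using measurable_sets[OF f that(2)] by simp
    then show ?thesis using that by (simp add: R h_integral)
  qed
  have R_UNIV: "emeasure (R B) UNIV = emeasure Q B" if "B \<in> sets borel" for B
  proof -
    have "emeasure (R B) UNIV = emeasure \<gamma> (UNIV \<times> B)" using R_preimage[OF that, of UNIV] by simp
    also have "\<dots> = emeasure Q B"
      unfolding couplings_snd[OF \<gamma>, symmetric] using that
      by (subst emeasure_distr) (auto simp: couplings_space[OF \<gamma>] intro!: arg_cong[where f="emeasure \<gamma>"])
    finally show ?thesis .
  qed
  have finite_R: "finite_measure (R B)" if "B \<in> sets borel" for B
    by (rule finite_measureI) (simp add: space_R R_UNIV[OF that])
  \<comment> \<open>Uniqueness of Radon-Nikodym densities makes \<open>h\<close> additive in \<open>B\<close> up to null sets.\<close>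
  have R_add: "emeasure (R (B \<union> B')) A = emeasure (R B) A + emeasure (R B') A"
    if B[measurable]: "B \<in> sets borel" "B' \<in> sets borel" and disj: "B \<inter> B' = {}"
      and A[measurable]: "A \<in> sets borel" for A B B'
  proof -
    have "density \<mu> (h (B \<union> B')) = density \<mu> (\<lambda>x. h B x + h B' x)"
    proof (rule measure_eqI)
      fix C assume "C \<in> sets (density \<mu> (h (B \<union> B')))"
      then have C[measurable]: "C \<in> sets borel" by (simp add: sets_\<mu>)
      have "emeasure (density \<mu> (h (B \<union> B'))) C = emeasure \<gamma> (C \<times> B \<union> C \<times> B')"
        by (simp add: density_h emeasure_slice Sigma_Un_distrib2)
      also have "\<dots> = emeasure \<gamma> (C \<times> B) + emeasure \<gamma> (C \<times> B')"
        using disj by (intro plus_emeasure[symmetric] rect) auto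
      also have "\<dots> = emeasure (density \<mu> (h B)) C + emeasure (density \<mu> (h B')) C"
        by (simp add: density_h emeasure_slice)
      also have "\<dots> = emeasure (density \<mu> (\<lambda>x. h B x + h B' x)) C"
        by (simp add: emeasure_density distrib_right nn_integral_add)
      finally show "emeasure (density \<mu> (h (B \<union> B'))) C
          = emeasure (density \<mu> (\<lambda>x. h B x + h B' x)) C" .
    qed simp
    then have "AE x in \<mu>. h (B \<union> B') x = h B x + h B' x"
      by (subst (asm) \<mu>.density_unique_iff) auto
    then have "AE z in P. h (B \<union> B') (f z) = h B (f z) + h B' (f z)"
      unfolding \<mu>_def by (subst (asm) AE_distr_iff) auto
    then have "(\<integral>\<^sup>+z. h (B \<union> B') (f z) * indicator A z \<partial>P)
        = (\<integral>\<^sup>+z. h B (f z) * indicator A z + h B' (f z) * indicator A z \<partial>P)"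
      by (intro nn_integral_cong_AE) (auto simp: distrib_right)
    also have "\<dots> = (\<integral>\<^sup>+z. h B (f z) * indicator A z \<partial>P) + (\<integral>\<^sup>+z. h B' (f z) * indicator A z \<partial>P)"
      by (rule nn_integral_add) auto
    finally show ?thesis using A by (simp add: R)
  qed
  have "density \<mu> (h UNIV) = density \<mu> (\<lambda>_. 1)"
  proof (rule measure_eqI)
    fix C assume "C \<in> sets (density \<mu> (h UNIV))"
    then have C[measurable]: "C \<in> sets borel" by (simp add: sets_\<mu>)
    have "emeasure (density \<mu> (h UNIV)) C = emeasure \<gamma> (C \<times> UNIV)"
      by (simp add: density_h emeasure_slice)
    also have "\<dots> = emeasure \<mu> C"
      unfolding \<mu>_def couplings_fst[OF \<gamma>, symmetric]
      by (subst emeasure_distr) (auto simp: couplings_space[OF \<gamma>] intro!: arg_cong[where f="emeasure \<gamma>"])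
    finally show "emeasure (density \<mu> (h UNIV)) C = emeasure (density \<mu> (\<lambda>_. 1)) C"
      by (simp add: density_1)
  qed simp
  then have "AE x in \<mu>. h UNIV x = 1"
    by (subst (asm) \<mu>.density_unique_iff) auto
  then have h_UNIV: "AE z in P. h UNIV (f z) = 1"
    unfolding \<mu>_def by (subst (asm) AE_distr_iff) auto
  have R_univ: "emeasure (R UNIV) A = emeasure P A" if A[measurable]: "A \<in> sets borel" for A
  proof -
    have "emeasure (R UNIV) A = (\<integral>\<^sup>+z. indicator A z \<partial>P)"
      unfolding R[OF A] using h_UNIV by (intro nn_integral_cong_AE) auto
    then show ?thesis by simp
  qed
  define b where "b = (\<lambda>(A, B). if B \<in> sets borel then measure (R B) A else 0)"
  have "b \<in> bimeasures P Q"
    unfolding bimeasures_def mem_Collect_eq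
  proof (intro conjI allI ballI impI)
    fix A B
    show "0 \<le> b (A, B)" by (simp add: b_def)
    show "b (A, B) \<le> 1"
    proof (cases "B \<in> sets borel")
      case True
      interpret R: finite_measure "R B" by (rule finite_R[OF True])
      have "measure (R B) A \<le> measure (R B) (space (R B))" by (rule R.bounded_measure)
      also have "\<dots> = measure Q B" using R_UNIV[OF True] by (simp add: measure_def space_R)
      also have "\<dots> \<le> 1" by simp
      finally show ?thesis by (simp add: b_def True)
    qed (simp add: b_def)
  next
    fix A A' :: "'s set" and B :: "'t set"
    assume AB: "A \<in> sets borel" "A' \<in> sets borel" "B \<in> sets borel" "A \<inter> A' = {}"
    interpret R: finite_measure "R B" by (rule finite_R[OF AB(3)])
    show "b (A \<union> A', B) = b (A, B) + b (A', B)"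
      using AB by (simp add: b_def R.finite_measure_Union sets_R)
  next
    fix A :: "'s set" and B B' :: "'t set"
    assume AB: "A \<in> sets borel" "B \<in> sets borel" "B' \<in> sets borel" "B \<inter> B' = {}"
    interpret R: finite_measure "R B" by (rule finite_R[OF AB(2)])
    interpret R': finite_measure "R B'" by (rule finite_R[OF AB(3)])
    have "emeasure (R (B \<union> B')) A = ennreal (measure (R B) A + measure (R B') A)"
      using R_add[OF AB(2-4,1)] by (simp add: R.emeasure_eq_measure R'.emeasure_eq_measure)
    then have "measure (R (B \<union> B')) A = measure (R B) A + measure (R B') A"
      by (simp only: measure_def[of "R (B \<union> B')"] enn2real_ennreal add_nonneg_nonneg measure_nonneg)
    then show "b (A, B \<union> B') = b (A, B) + b (A, B')"
      using AB by (simp add: b_def)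
  next
    fix A :: "'s set" assume "A \<in> sets borel"
    then show "b (A, UNIV) = measure P A" by (simp add: b_def measure_def R_univ)
  next
    fix B :: "'t set" assume "B \<in> sets borel"
    then show "b (UNIV, B) = measure Q B" by (simp add: b_def measure_def R_UNIV)
  qed
  then have G: "coupling_of P Q b \<in> couplings P Q"
    and measure_G: "\<And>A B. A \<in> sets borel \<Longrightarrow> B \<in> sets borel \<Longrightarrow>
      measure (coupling_of P Q b) (A \<times> B) = b (A, B)"
    using coupling_of_couplings measure_coupling_of by blast+
  let ?G = "coupling_of P Q b"
  have lift: "distr ?G borel (\<lambda>z. (f (fst z), snd z)) \<in> couplings (distr P borel f) (distr Q borel (\<lambda>y. y))"
    by (rule couplings_distr[OF G f]) simp
  have "distr ?G borel (\<lambda>z. (f (fst z), snd z)) = \<gamma>"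
  proof (rule measure_eqI_borel_rectangles)
    fix C :: "'x set" and B :: "'t set" assume CB[measurable]: "C \<in> sets borel" "B \<in> sets borel"
    note [measurable_cong] = couplings_sets_pair[OF G]
    have "(\<lambda>z. (f (fst z), snd z)) \<in> measurable ?G borel"
      unfolding borel_prod[symmetric] by measurable
    moreover have "C \<times> B \<in> sets borel" using rect[OF CB] by (simp add: couplings_sets[OF \<gamma>])
    ultimately have "measure (distr ?G borel (\<lambda>z. (f (fst z), snd z))) (C \<times> B)
        = measure ?G ((\<lambda>z. (f (fst z), snd z)) -` (C \<times> B) \<inter> space ?G)"
      by (rule measure_distr)
    also have "(\<lambda>z. (f (fst z), snd z)) -` (C \<times> B) \<inter> space ?G = (f -` C) \<times> B"
      by (auto simp: couplings_space[OF G])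
    also have "measure ?G ((f -` C) \<times> B) = measure (R B) (f -` C)"
      using CB measurable_sets[OF f CB(1)] by (subst measure_G) (auto simp: b_def)
    also have "\<dots> = measure \<gamma> (C \<times> B)"
      by (simp add: measure_def R_preimage[OF CB(2,1)])
    finally show "measure (distr ?G borel (\<lambda>z. (f (fst z), snd z))) (C \<times> B) = measure \<gamma> (C \<times> B)" .
  next
    show "finite_measure (distr ?G borel (\<lambda>z. (f (fst z), snd z)))"
      by (rule prob_space.finite_measure[OF couplings_prob_space[OF lift]])
  qed (simp_all add: couplings_sets[OF \<gamma>] \<gamma>.finite_measure_axioms)
  with G that show ?thesis by blast
qed

text \<open>
  The one-sided result is used twice, with the factors exchanged in between.
\<close>

lemma (in polish_marginals) lift_coupling:
  fixes f :: "'s \<Rightarrow> 'x::{second_countable_topology, complete_space}"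
    and g :: "'t \<Rightarrow> 'y::{second_countable_topology, complete_space}"
  assumes f[measurable]: "f \<in> borel_measurable borel" and g[measurable]: "g \<in> borel_measurable borel"
    and \<gamma>: "\<gamma> \<in> couplings (distr P borel f) (distr Q borel g)"
  obtains G where "G \<in> couplings P Q" "distr G borel (\<lambda>z. (f (fst z), g (snd z))) = \<gamma>"
proof -
  note [measurable_cong] = sets_P sets_Q
  have "prob_space (distr Q borel g)" by (rule Q.prob_space_distr) measurable
  then interpret left: polish_marginals P "distr Q borel g"
    by (intro polish_marginals.intro prob_P sets_P) simp_all
  interpret right: polish_marginals Q P
    by (intro polish_marginals.intro prob_P prob_Q sets_P sets_Q)
  obtain H where H: "H \<in> couplings P (distr Q borel g)"
    "distr H borel (\<lambda>z. (f (fst z), snd z)) = \<gamma>"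
    using left.lift_coupling_left[OF f \<gamma>] .
  obtain K where K: "K \<in> couplings Q P" "distr K borel (\<lambda>z. (g (fst z), snd z)) = distr H borel prod.swap"
    using right.lift_coupling_left[OF g couplings_swap[OF H(1)]] .
  define G where "G = distr K borel prod.swap"
  have G: "G \<in> couplings P Q" unfolding G_def by (rule couplings_swap[OF K(1)])
  note [measurable_cong] = couplings_sets_pair[OF K(1)] couplings_sets_pair[OF H(1)]
  have swap: "prod.swap \<in> measurable K borel" "prod.swap \<in> measurable H borel"
    "(prod.swap :: 's \<times> 'y \<Rightarrow> _) \<in> borel_measurable borel"
    "(prod.swap :: 'y \<times> 's \<Rightarrow> _) \<in> borel_measurable borel"
    unfolding borel_prod[symmetric] prod.swap_def by measurable
  have meas: "(\<lambda>z. (f (fst z), snd z)) \<in> (borel :: ('s \<times> 'y) measure) \<rightarrow>\<^sub>M borel"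
    "(\<lambda>z. (g (fst z), snd z)) \<in> K \<rightarrow>\<^sub>M borel"
    "(\<lambda>z. (f (fst z), g (snd z))) \<in> (borel :: ('s \<times> 't) measure) \<rightarrow>\<^sub>M borel"
    unfolding borel_prod[symmetric] by measurable
  have "distr G borel (\<lambda>z. (f (fst z), g (snd z))) = distr K borel (\<lambda>z. (f (snd z), g (fst z)))"
    unfolding G_def using meas swap by (simp add: distr_distr comp_def)
  also have "\<dots> = distr (distr (distr K borel (\<lambda>z. (g (fst z), snd z))) borel prod.swap) borel
      (\<lambda>z. (f (fst z), snd z))"
    using meas swap by (simp add: distr_distr comp_def measurable_comp[unfolded comp_def])
  also have "\<dots> = distr (distr H borel (\<lambda>z. prod.swap (prod.swap z))) borel (\<lambda>z. (f (fst z), snd z))"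
    unfolding K(2) using swap by (subst distr_distr) (auto simp: comp_def)
  also have "distr H borel (\<lambda>z. prod.swap (prod.swap z)) = H"
    by (simp add: distr_id2 couplings_sets[OF H(1)])
  finally show ?thesis using G H(2) that by simp
qed

section \<open>The Wasserstein distance between push-forwards\<close>

context polish_marginals
begin

lemma quadratic_cost_distr:
  fixes f :: "'s \<Rightarrow> 'a::{real_inner, polish_space}" and g :: "'t \<Rightarrow> 'a"
  assumes f: "f \<in> square_integrable P" and g: "g \<in> square_integrable Q" and G: "G \<in> couplings P Q"
  shows "quadratic_cost (distr G borel (\<lambda>z. (f (fst z), g (snd z))))
    = ennreal (\<integral>z. (norm (f (fst z) - g (snd z)))\<^sup>2 \<partial>G)"
proof -
  note [measurable] = square_integrable_measurable[OF f] square_integrable_measurable[OF g]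
  note [measurable_cong] = couplings_sets_pair[OF G]
  have "(\<lambda>z. (f (fst z), g (snd z))) \<in> G \<rightarrow>\<^sub>M borel"
    unfolding borel_prod[symmetric] by measurable
  moreover have "(\<lambda>(x, y). ennreal ((norm (x - y))\<^sup>2)) \<in> borel_measurable (borel :: ('a \<times> 'a) measure)"
    unfolding borel_prod[symmetric] by measurable
  ultimately have "quadratic_cost (distr G borel (\<lambda>z. (f (fst z), g (snd z))))
      = (\<integral>\<^sup>+z. ennreal ((norm (f (fst z) - g (snd z)))\<^sup>2) \<partial>G)"
    unfolding quadratic_cost_def by (subst nn_integral_distr) auto
  also have "\<dots> = ennreal (\<integral>z. (norm (f (fst z) - g (snd z)))\<^sup>2 \<partial>G)"
    using integrable_inner_diff[OF f f g g G]
    by (intro nn_integral_eq_integral) (auto simp: power2_norm_eq_inner)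
  finally show ?thesis .
qed

text \<open>
  By \<open>lift_coupling\<close> the infimum defining \<open>W2\<close> may be taken over couplings of \<open>P\<close> and \<open>Q\<close>, and by
  compactness it is attained there. Reading the push-forwards through fixed measures \<open>P\<close> and \<open>Q\<close> is
  what allows \<open>f\<close> and \<open>g\<close> to vary while the set of competitors stays the same.
\<close>

theorem W2_square_lifted:
  fixes f :: "'s \<Rightarrow> 'a::{real_inner, polish_space}" and g :: "'t \<Rightarrow> 'a"
  assumes f: "f \<in> square_integrable P" and g: "g \<in> square_integrable Q"
  shows "is_minimum ((W2 (distr P borel f) (distr Q borel g))\<^sup>2)
    ((\<lambda>G. \<integral>z. (norm (f (fst z) - g (snd z)))\<^sup>2 \<partial>G) ` couplings P Q)"
proof -
  let ?c = "\<lambda>G. \<integral>z. (norm (f (fst z) - g (snd z)))\<^sup>2 \<partial>G"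
  note fg = square_integrable_measurable[OF f] square_integrable_measurable[OF g]
  have "compact ((\<lambda>G. (?c G, ?c G)) ` couplings P Q)"
    using compact_integral_inner_diff[OF f f g g f f g g] by (simp add: power2_norm_eq_inner)
  then have "compact (fst ` (\<lambda>G. (?c G, ?c G)) ` couplings P Q)"
    by (rule compact_continuous_image[rotated]) (intro continuous_intros)
  then have "compact (?c ` couplings P Q)" by (simp add: image_image)
  then obtain m where m: "m \<in> ?c ` couplings P Q" "\<And>y. y \<in> ?c ` couplings P Q \<Longrightarrow> m \<le> y"
    using compact_attains_inf[of "?c ` couplings P Q"] couplings_nonempty by auto
  then obtain G0 where G0: "G0 \<in> couplings P Q" "m = ?c G0" by blast
  have min: "?c G0 \<le> ?c G" if "G \<in> couplings P Q" for G
    using m(2)[OF imageI[OF that]] unfolding G0(2) .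
  have "(INF \<gamma>\<in>couplings (distr P borel f) (distr Q borel g). quadratic_cost \<gamma>) = ennreal (?c G0)"
  proof (rule antisym)
    show "(INF \<gamma>\<in>couplings (distr P borel f) (distr Q borel g). quadratic_cost \<gamma>) \<le> ennreal (?c G0)"
      using INF_lower[OF couplings_distr[OF G0(1) fg], of quadratic_cost]
      unfolding quadratic_cost_distr[OF f g G0(1)] .
    show "ennreal (?c G0) \<le> (INF \<gamma>\<in>couplings (distr P borel f) (distr Q borel g). quadratic_cost \<gamma>)"
    proof (rule INF_greatest)
      fix \<gamma> assume "\<gamma> \<in> couplings (distr P borel f) (distr Q borel g)"
      then obtain G where G: "G \<in> couplings P Q" "distr G borel (\<lambda>z. (f (fst z), g (snd z))) = \<gamma>"
        using lift_coupling[OF fg] by metis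
      have "quadratic_cost \<gamma> = ennreal (?c G)"
        using quadratic_cost_distr[OF f g G(1)] unfolding G(2) .
      then show "ennreal (?c G0) \<le> quadratic_cost \<gamma>"
        using min[OF G(1)] by (simp add: ennreal_leI)
    qed
  qed
  then have "(W2 (distr P borel f) (distr Q borel g))\<^sup>2 = m"
    by (simp add: W2_def G0(2))
  then show ?thesis using m by (simp add: is_minimum_def)
qed

lemma distr_in_optimal_couplings_iff:
  fixes f :: "'s \<Rightarrow> 'a::{real_inner, polish_space}" and g :: "'t \<Rightarrow> 'a"
  assumes f: "f \<in> square_integrable P" and g: "g \<in> square_integrable Q" and G: "G \<in> couplings P Q"
  shows "distr G borel (\<lambda>z. (f (fst z), g (snd z))) \<in> optimal_couplings (distr P borel f) (distr Q borel g)
    \<longleftrightarrow> (\<integral>z. (norm (f (fst z) - g (snd z)))\<^sup>2 \<partial>G) = (W2 (distr P borel f) (distr Q borel g))\<^sup>2"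
  using couplings_distr[OF G square_integrable_measurable[OF f] square_integrable_measurable[OF g]]
  by (simp add: optimal_couplings_def quadratic_cost_distr[OF f g G])

end

section \<open>One-sided derivative of a minimum over a compact set\<close>

text \<open>
  Here \<open>K\<close> collects the values \<open>\<alpha>\<close> and the slopes \<open>\<beta>\<close> at \<open>s = 0\<close> of the competing costs, so that
  \<open>F s\<close> is the minimum of \<open>\<alpha> + 2 s \<beta>\<close> up to an error of second order. The minimal slope \<open>m\<close> among
  the minimisers bounds the difference quotient from above in the limit. For the lower bound, the
  competitors with slope at most \<open>l < m\<close> form a compact set without minimisers, so their values exceed
  \<open>F 0\<close> by a fixed amount \<open>d\<close>; as \<open>s\<close> tends to \<open>0\<close>, a gain of order \<open>s\<close> in the slope cannot make up
  for this.
\<close>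

lemma tendsto_difference_quotient_compact_minimum:
  fixes K :: "(real \<times> real) set" and F :: "real \<Rightarrow> real"
  assumes K: "compact K"
    and lower: "\<And>s. 0 < s \<Longrightarrow> \<exists>(\<alpha>, \<beta>)\<in>K. \<alpha> + 2 * s * \<beta> \<le> F s"
    and upper: "\<And>s \<alpha> \<beta>. 0 < s \<Longrightarrow> (\<alpha>, \<beta>) \<in> K \<Longrightarrow> F s \<le> \<alpha> + 2 * s * \<beta> + s\<^sup>2 * C"
    and min0: "\<And>\<alpha> \<beta>. (\<alpha>, \<beta>) \<in> K \<Longrightarrow> F 0 \<le> \<alpha>"
    and m: "(F 0, m) \<in> K" "\<And>\<beta>. (F 0, \<beta>) \<in> K \<Longrightarrow> m \<le> \<beta>"
  shows "((\<lambda>s. (F s - F 0) / (2 * s)) \<longlongrightarrow> m) (at_right 0)"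
proof (rule order_tendstoI)
  fix u assume "m < u"
  have "((\<lambda>s. m + s * C / 2) \<longlongrightarrow> m + 0 * C / 2) (at_right 0)"
    by (intro tendsto_intros) simp
  then have "\<forall>\<^sub>F s in at_right 0. m + s * C / 2 < u"
    using \<open>m < u\<close> by (intro order_tendstoD) auto
  then show "\<forall>\<^sub>F s in at_right 0. (F s - F 0) / (2 * s) < u"
    using eventually_at_right_less[of "0::real"]
  proof eventually_elim
    case (elim s)
    have "(F s - F 0) / (2 * s) \<le> m + s * C / 2"
      using upper[OF elim(2) m(1)] elim(2) by (simp add: field_simps power2_eq_square)
    then show ?case using elim(1) by linarith
  qed
next
  fix l assume "l < m"
  define K' where "K' = K \<inter> {z. snd z \<le> l}"
  have "closed {z :: real \<times> real. snd z \<le> l}"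
    by (intro closed_Collect_le continuous_intros)
  then have K': "compact K'" unfolding K'_def by (rule compact_Int_closed[OF K])
  obtain d where d: "0 < d" "\<And>\<alpha> \<beta>. (\<alpha>, \<beta>) \<in> K' \<Longrightarrow> F 0 + d \<le> \<alpha>"
  proof (cases "K' = {}")
    case True
    with that[of 1] show ?thesis by simp
  next
    case False
    then obtain z where z: "z \<in> K'" "\<And>y. y \<in> K' \<Longrightarrow> fst z \<le> fst y"
      using continuous_attains_inf[OF K', of fst] continuous_on_fst[OF continuous_on_id] by blast
    obtain \<alpha> \<beta> where z': "z = (\<alpha>, \<beta>)" by (cases z)
    have "F 0 \<noteq> \<alpha>"
    proof
      assume "F 0 = \<alpha>"
      then have "m \<le> \<beta>" using z(1) by (intro m(2)) (simp add: K'_def z')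
      then show False using z(1) \<open>l < m\<close> by (simp add: K'_def z')
    qed
    moreover have "F 0 \<le> \<alpha>" using z(1) by (intro min0[of \<alpha> \<beta>]) (simp add: K'_def z')
    ultimately show ?thesis using that[of "\<alpha> - F 0"] z(2) by (force simp: z')
  qed
  have "bounded (snd ` K')"
    by (intro compact_imp_bounded compact_continuous_image K' continuous_intros)
  then obtain B where bound: "\<forall>y\<in>snd ` K'. \<bar>y\<bar> \<le> B" unfolding bounded_real by blast
  have B: "- B \<le> \<beta>" if "(\<alpha>, \<beta>) \<in> K'" for \<alpha> \<beta>
    using bound imageI[OF that, of snd] by (auto simp: abs_le_iff)
  have "((\<lambda>s. d - 2 * s * (B + l)) \<longlongrightarrow> d - 2 * 0 * (B + l)) (at_right 0)"
    by (intro tendsto_intros)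
  then have "\<forall>\<^sub>F s in at_right 0. 0 < d - 2 * s * (B + l)"
    using d(1) by (intro order_tendstoD) auto
  then show "\<forall>\<^sub>F s in at_right 0. l < (F s - F 0) / (2 * s)"
    using eventually_at_right_less[of "0::real"]
  proof eventually_elim
    case (elim s)
    obtain \<alpha> \<beta> where z: "(\<alpha>, \<beta>) \<in> K" "\<alpha> + 2 * s * \<beta> \<le> F s"
      using lower[OF elim(2)] by blast
    have "2 * s * l < F s - F 0"
    proof (cases "l < \<beta>")
      case True
      then have "2 * s * l < 2 * s * \<beta>" using elim(2) by simp
      then show ?thesis using z(2) min0[OF z(1)] by linarith
    next
      case False
      then have zK: "(\<alpha>, \<beta>) \<in> K'" using z(1) by (simp add: K'_def)
      have "2 * s * (- B) \<le> 2 * s * \<beta>" using B[OF zK] elim(2) by (intro mult_left_mono) auto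
      then show ?thesis using d(2)[OF zK] z(2) elim(1) by (simp add: algebra_simps)
    qed
    then show ?case using elim(2) by (simp add: field_simps)
  qed
qed

section \<open>Directional derivatives of the squared Wasserstein distance\<close>

context polish_marginals
begin

text \<open>
  The points \<open>a x\<close> and \<open>b y\<close> move with velocities \<open>p x\<close> and \<open>q y\<close>. Leaving the spaces carrying \<open>P\<close>
  and \<open>Q\<close> abstract covers both pairings at once.
\<close>

theorem W2_square_derivative_is_minimum:
  fixes a p :: "'s \<Rightarrow> 'a::{real_inner, polish_space}" and b q :: "'t \<Rightarrow> 'a"
  assumes ap: "a \<in> square_integrable P" "p \<in> square_integrable P"
    and bq: "b \<in> square_integrable Q" "q \<in> square_integrable Q"
  shows "is_minimum
    (Lim (at_right 0) (\<lambda>s. ((W2 (distr P borel (\<lambda>x. a x + s *\<^sub>R p x)) (distr Q borel (\<lambda>y. b y + s *\<^sub>R q y)))\<^sup>2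
        - (W2 (distr P borel a) (distr Q borel b))\<^sup>2) / (2 * s)))
    {\<integral>z. (a (fst z) - b (snd z)) \<bullet> (p (fst z) - q (snd z)) \<partial>G | G. G \<in> couplings P Q \<and>
       distr G borel (\<lambda>z. (a (fst z), b (snd z))) \<in> optimal_couplings (distr P borel a) (distr Q borel b)}"
proof -
  define F where "F s = (W2 (distr P borel (\<lambda>x. a x + s *\<^sub>R p x)) (distr Q borel (\<lambda>y. b y + s *\<^sub>R q y)))\<^sup>2"
    for s :: real
  have F0: "(W2 (distr P borel a) (distr Q borel b))\<^sup>2 = F 0" by (simp add: F_def)
  define \<alpha> where "\<alpha> G = (\<integral>z. (norm (a (fst z) - b (snd z)))\<^sup>2 \<partial>G)" for G :: "('s \<times> 't) measure"
  define \<beta> where "\<beta> G = (\<integral>z. (a (fst z) - b (snd z)) \<bullet> (p (fst z) - q (snd z)) \<partial>G)"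
    for G :: "('s \<times> 't) measure"
  define C where "C = 2 * (\<integral>x. (norm (p x))\<^sup>2 \<partial>P) + 2 * (\<integral>y. (norm (q y))\<^sup>2 \<partial>Q)"
  define K where "K = (\<lambda>G. (\<alpha> G, \<beta> G)) ` couplings P Q"
  have K: "compact K"
    unfolding K_def \<alpha>_def \<beta>_def power2_norm_eq_inner
    by (intro compact_integral_inner_diff ap bq)
  have F: "is_minimum (F s)
      ((\<lambda>G. \<integral>z. (norm ((a (fst z) + s *\<^sub>R p (fst z)) - (b (snd z) + s *\<^sub>R q (snd z))))\<^sup>2 \<partial>G) ` couplings P Q)" for s
    unfolding F_def
    by (rule W2_square_lifted[OF square_integrable_add_scaleR[OF sets_P ap]
          square_integrable_add_scaleR[OF sets_Q bq]])
  have expand: "(\<integral>z. (norm ((a (fst z) + s *\<^sub>R p (fst z)) - (b (snd z) + s *\<^sub>R q (snd z))))\<^sup>2 \<partial>G)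
      = \<alpha> G + 2 * s * \<beta> G + s\<^sup>2 * (\<integral>z. (norm (p (fst z) - q (snd z)))\<^sup>2 \<partial>G)"
    if G: "G \<in> couplings P Q" for s G
  proof -
    have "(norm ((a x + s *\<^sub>R p x) - (b y + s *\<^sub>R q y)))\<^sup>2
        = (norm (a x - b y))\<^sup>2 + 2 * s * ((a x - b y) \<bullet> (p x - q y)) + s\<^sup>2 * (norm (p x - q y))\<^sup>2" for x y
    proof -
      have square: "(norm (u + s *\<^sub>R v))\<^sup>2 = (norm u)\<^sup>2 + 2 * s * (u \<bullet> v) + s\<^sup>2 * (norm v)\<^sup>2"
        for u v :: 'a
        unfolding power2_norm_eq_inner
        by (simp add: inner_add_left inner_add_right inner_commute power2_eq_square algebra_simps)
      have "(a x + s *\<^sub>R p x) - (b y + s *\<^sub>R q y) = (a x - b y) + s *\<^sub>R (p x - q y)"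
        by (simp add: algebra_simps)
      then show ?thesis by (simp only: square)
    qed
    then show ?thesis
      unfolding \<alpha>_def \<beta>_def
      using integrable_inner_diff[OF ap(1) ap(1) bq(1) bq(1) G] integrable_inner_diff[OF ap bq G]
        integrable_inner_diff[OF ap(2) ap(2) bq(2) bq(2) G]
      by (simp add: power2_norm_eq_inner)
  qed
  have quadratic: "(\<integral>z. (norm (p (fst z) - q (snd z)))\<^sup>2 \<partial>G) \<le> C" if G: "G \<in> couplings P Q" for G
  proof -
    note p = square_integrable_fst[OF G ap(2)] and q = square_integrable_snd[OF G bq(2)]
    have "(\<integral>z. (norm (p (fst z) - q (snd z)))\<^sup>2 \<partial>G)
        \<le> (\<integral>z. 2 * (norm (p (fst z)))\<^sup>2 + 2 * (norm (q (snd z)))\<^sup>2 \<partial>G)"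
    proof (rule integral_mono)
      show "integrable G (\<lambda>z. (norm (p (fst z) - q (snd z)))\<^sup>2)"
        using integrable_inner_diff[OF ap(2) ap(2) bq(2) bq(2) G] by (simp add: power2_norm_eq_inner)
      show "integrable G (\<lambda>z. 2 * (norm (p (fst z)))\<^sup>2 + 2 * (norm (q (snd z)))\<^sup>2)"
        using p[THEN square_integrable_integrable] q[THEN square_integrable_integrable] by simp
      show "(norm (p (fst z) - q (snd z)))\<^sup>2 \<le> 2 * (norm (p (fst z)))\<^sup>2 + 2 * (norm (q (snd z)))\<^sup>2" for z
        using norm_add_scaleR_power2_le[of "p (fst z)" "-1" "q (snd z)"] by simp
    qed
    also have "\<dots> = C"
      using p[THEN square_integrable_integrable] q[THEN square_integrable_integrable]
      by (simp add: C_def integral_norm_fst[OF G ap(2)] integral_norm_snd[OF G bq(2)])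
    finally show ?thesis .
  qed
  have min0: "F 0 \<le> \<alpha> G" if G: "G \<in> couplings P Q" for G
    using F[of 0] G by (auto simp: is_minimum_def \<alpha>_def)
  have "\<exists>G\<in>couplings P Q. F 0 = \<alpha> G"
    using F[of 0] by (auto simp: is_minimum_def \<alpha>_def)
  then have "K \<inter> {z. fst z = F 0} \<noteq> {}" by (auto simp: K_def)
  moreover have "closed {z :: real \<times> real. fst z = F 0}"
    by (intro closed_Collect_eq continuous_intros)
  then have "compact (K \<inter> {z. fst z = F 0})" by (rule compact_Int_closed[OF K])
  ultimately obtain z where z: "z \<in> K \<inter> {z. fst z = F 0}"
    "\<And>y. y \<in> K \<inter> {z. fst z = F 0} \<Longrightarrow> snd z \<le> snd y"
    using continuous_attains_inf[of "K \<inter> {z. fst z = F 0}" snd] continuous_on_snd[OF continuous_on_id]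
    by blast
  define m where "m = snd z"
  have m: "(F 0, m) \<in> K" using z(1) by (cases z) (auto simp: m_def)
  have m_le: "m \<le> \<beta>'" if "(F 0, \<beta>') \<in> K" for \<beta>'
    using z(2)[of "(F 0, \<beta>')"] that by (simp add: m_def)
  have "((\<lambda>s. (F s - F 0) / (2 * s)) \<longlongrightarrow> m) (at_right 0)"
  proof (rule tendsto_difference_quotient_compact_minimum[where F=F and K=K and m=m and C=C])
    fix s :: real assume "0 < s"
    obtain G where G: "G \<in> couplings P Q"
      "F s = \<alpha> G + 2 * s * \<beta> G + s\<^sup>2 * (\<integral>z. (norm (p (fst z) - q (snd z)))\<^sup>2 \<partial>G)"
      using F[of s] expand[of _ s] unfolding is_minimum_def by auto
    have "\<alpha> G + 2 * s * \<beta> G \<le> F s"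
      unfolding G(2) by simp
    with G(1) show "\<exists>(\<alpha>, \<beta>)\<in>K. \<alpha> + 2 * s * \<beta> \<le> F s"
      by (auto simp: K_def)
  next
    fix s \<alpha>' \<beta>' :: real assume "0 < s" "(\<alpha>', \<beta>') \<in> K"
    then obtain G where G: "G \<in> couplings P Q" "\<alpha>' = \<alpha> G" "\<beta>' = \<beta> G" by (auto simp: K_def)
    have "F s \<le> \<alpha> G + 2 * s * \<beta> G + s\<^sup>2 * (\<integral>z. (norm (p (fst z) - q (snd z)))\<^sup>2 \<partial>G)"
      using F[of s] G(1) unfolding is_minimum_def expand[OF G(1), symmetric] by blast
    also have "\<dots> \<le> \<alpha> G + 2 * s * \<beta> G + s\<^sup>2 * C"
      using quadratic[OF G(1)] by (intro add_left_mono mult_left_mono) auto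
    finally show "F s \<le> \<alpha>' + 2 * s * \<beta>' + s\<^sup>2 * C" by (simp add: G)
  qed (use K m m_le min0 in \<open>auto simp: K_def\<close>)
  then have "Lim (at_right 0) (\<lambda>s. (F s - F 0) / (2 * s)) = m"
    by (intro tendsto_Lim trivial_limit_at_right_real)
  moreover have "is_minimum m {\<beta> G | G. G \<in> couplings P Q \<and> \<alpha> G = F 0}"
  proof -
    obtain G where "G \<in> couplings P Q" "\<alpha> G = F 0" "m = \<beta> G" using m by (auto simp: K_def)
    moreover have "m \<le> \<beta> G" if "G \<in> couplings P Q" "\<alpha> G = F 0" for G
      using that m_le[of "\<beta> G"] imageI[OF that(1), of "\<lambda>G. (\<alpha> G, \<beta> G)"] by (simp add: K_def)
    ultimately show ?thesis unfolding is_minimum_def by blast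
  qed
  moreover have "distr G borel (\<lambda>z. (a (fst z), b (snd z))) \<in> optimal_couplings (distr P borel a) (distr Q borel b)
      \<longleftrightarrow> \<alpha> G = F 0" if "G \<in> couplings P Q" for G
    using distr_in_optimal_couplings_iff[OF ap(1) bq(1) that] by (simp add: \<alpha>_def F0)
  then have "{\<beta> G | G. G \<in> couplings P Q \<and>
       distr G borel (\<lambda>z. (a (fst z), b (snd z))) \<in> optimal_couplings (distr P borel a) (distr Q borel b)}
      = {\<beta> G | G. G \<in> couplings P Q \<and> \<alpha> G = F 0}"
    by blast
  ultimately show ?thesis unfolding F0 \<beta>_def F_def by simp
qed

end

lemma P2_prob_space: "M \<in> P2 \<Longrightarrow> prob_space M"
  and P2_sets: "M \<in> P2 \<Longrightarrow> sets M = sets borel"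
  by (auto simp: P2_def)

lemma P2_square_integrable_id:
  fixes M :: "'a::{real_normed_vector, second_countable_topology} measure"
  assumes M: "M \<in> P2"
  shows "(\<lambda>x. x) \<in> square_integrable M"
proof (rule square_integrableI)
  note [measurable_cong] = P2_sets[OF M]
  show "integrable M (\<lambda>x. (norm x)\<^sup>2)"
  proof (rule integrableI_nonneg)
    show "(\<integral>\<^sup>+x. ennreal ((norm x)\<^sup>2) \<partial>M) < \<infinity>" using M by (simp add: P2_def)
  qed simp_all
qed simp

lemma P2_square_integrable_components:
  fixes \<Phi> :: "('a::{real_normed_vector, second_countable_topology} \<times> 'a) measure"
  assumes \<Phi>: "\<Phi> \<in> P2"
  shows "fst \<in> square_integrable \<Phi>" "snd \<in> square_integrable \<Phi>"
proof -
  note [measurable_cong] = P2_sets[OF \<Phi>]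
  have meas[measurable]: "fst \<in> borel_measurable (borel :: ('a \<times> 'a) measure)"
    "snd \<in> borel_measurable (borel :: ('a \<times> 'a) measure)"
    by (simp_all add: borel_measurable_continuous_onI continuous_on_fst continuous_on_snd)
  note int = square_integrable_integrable[OF P2_square_integrable_id[OF \<Phi>]]
  have "integrable \<Phi> (\<lambda>z. (norm (fst z))\<^sup>2)"
    by (rule Bochner_Integration.integrable_bound[OF int], measurable)
      (auto intro!: AE_I2 power_mono simp: norm_fst_le)
  then show "fst \<in> square_integrable \<Phi>" using meas by (intro square_integrableI)
  have "integrable \<Phi> (\<lambda>z. (norm (snd z))\<^sup>2)"
    by (rule Bochner_Integration.integrable_bound[OF int], measurable)
      (auto intro!: AE_I2 power_mono simp: norm_snd_le)
  then show "snd \<in> square_integrable \<Phi>" using meas by (intro square_integrableI)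
qed

lemma polish_marginals_P2:
  fixes M :: "'a::{real_normed_vector, second_countable_topology, complete_space} measure"
    and N :: "'b::{real_normed_vector, second_countable_topology, complete_space} measure"
  assumes "M \<in> P2" "N \<in> P2"
  shows "polish_marginals M N"
  using assms by (intro polish_marginals.intro P2_prob_space P2_sets)

theorem theorem3p9:
  fixes \<Phi>0 \<Phi>1 :: "('a::{real_inner, polish_space} \<times> 'a) measure"
    and \<mu>1 :: "'a measure"
  assumes "\<Phi>0 \<in> P2" and "\<Phi>1 \<in> P2" and "\<mu>1 \<in> P2"
  shows "is_minimum (pairing_base \<Phi>0 \<mu>1)
           {\<integral>((x0, v0), x1). (x0 - x1) \<bullet> v0 \<partial>\<sigma> | \<sigma>. \<sigma> \<in> Lambda_base \<Phi>0 \<mu>1}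
       \<and> is_minimum (pairing \<Phi>0 \<Phi>1)
           {\<integral>((x0, v0), (x1, v1)). (x0 - x1) \<bullet> (v0 - v1) \<partial>\<Theta> | \<Theta>. \<Theta> \<in> Lambda \<Phi>0 \<Phi>1}"
proof
  interpret base: polish_marginals \<Phi>0 \<mu>1 by (rule polish_marginals_P2) fact+
  have zero: "(\<lambda>_. 0 :: 'a) \<in> square_integrable \<mu>1" by (rule square_integrableI) auto
  have "distr \<mu>1 borel (\<lambda>x. x) = \<mu>1" by (simp add: distr_id2 P2_sets[OF assms(3)])
  then show "is_minimum (pairing_base \<Phi>0 \<mu>1)
      {\<integral>((x0, v0), x1). (x0 - x1) \<bullet> v0 \<partial>\<sigma> | \<sigma>. \<sigma> \<in> Lambda_base \<Phi>0 \<mu>1}"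
    using base.W2_square_derivative_is_minimum[OF P2_square_integrable_components[OF assms(1)]
        P2_square_integrable_id[OF assms(3)] zero]
    by (simp add: pairing_base_def Lambda_base_def exp_map_def case_prod_beta')
  interpret tangent: polish_marginals \<Phi>0 \<Phi>1 by (rule polish_marginals_P2) fact+
  show "is_minimum (pairing \<Phi>0 \<Phi>1)
      {\<integral>((x0, v0), (x1, v1)). (x0 - x1) \<bullet> (v0 - v1) \<partial>\<Theta> | \<Theta>. \<Theta> \<in> Lambda \<Phi>0 \<Phi>1}"
    using tangent.W2_square_derivative_is_minimum[OF P2_square_integrable_components[OF assms(1)]
        P2_square_integrable_components[OF assms(2)]]
    by (simp add: pairing_def Lambda_def exp_map_def case_prod_beta')
qed

end
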